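(* Let $\mathcal V$ be a Euclidean Jordan algebra and let $a\in\mathcal V$. Let $F:\mathcal V\to\mathbb R$ be a strictly Schur-convex spectral function, and let $\Omega\subset\mathcal V$ be a weakly spectral set. Let $\bar x$ be a local optimizer (minimizer or maximizer) of $F(x-a)$ for $x\in\Omega$. Then $a$ and $\bar x$ operator commute.
   Context: A Euclidean Jordan algebra (EJA) $\mathcal V$ is a finite-dimensional real inner product space with a commutative bilinear product $\circ$ satisfying the Jordan identity $(x\circ y)\circ(x\circ x)=x\circ(y\circ(x\circ x))$, having a unit $e$, and with $\langle x\circ y,z\rangle=\langle y,x\circ z\rangle$. A primitive idempotent is a nonzero $c$ with $c\circ c=c$ that is not a sum of two nonzero idempotents. A Jordan frame is a collection $\{e_1,\dots,e_n\}$ of primitive idempotents with $\sum_i e_i=e$ and $e_i\circ e_j=0$ for $i\ne j$; $n$ is the rank of $\mathcal V$. Every $x\in\mathcal V$ has a spectral decomposition $x=\sum_{i=1}^n\lambda_i(x)e_i$ for some Jordan frame, where $\lambda_1(x)\ge\dots\ge\lambda_n(x)$ are the (uniquely determined) eigenvalues of $x$; $\lambda(x)=(\lambda_1(x),\dots,\lambda_n(x))\in\mathbb R^n$. Two elements $a,b\in\mathcal V$ operator commute if $L_aL_b=L_bL_a$, where $L_a(x)=a\circ x$; equivalently, there is a Jordan frame $\{e_1,\dots,e_n\}$ such that both $a$ and $b$ are real linear combinations of $e_1,\dots,e_n$. An automorphism of $\mathcal V$ is an invertible linear map $X:\mathcal V\to\mathcal V$ with $X(a\circ b)=Xa\circ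 Xb$ for all $a,b$. A set $\Omega\subseteq\mathcal V$ is weakly spectral if $Ax\in\Omega$ for every $x\in\Omega$ and every automorphism $A$ of $\mathcal V$. A function $F:\mathcal V\to\mathbb R$ is a spectral function if $F(x)=f(\lambda(x))$ for all $x$, for some permutation-invariant (symmetric) $f:\mathbb R^n\to\mathbb R$. For $u\in\mathbb R^n$, $u^\downarrow$ is the nonincreasing rearrangement of $u$. One writes $u\prec v$ if $\sum_{i=1}^k u_i^\downarrow\le\sum_{i=1}^k v_i^\downarrow$ for $k=1,\dots,n$, with equality for $k=n$. $f$ is strictly Schur-convex if $u\prec v$ implies $f(u)\le f(v)$, and $f(u)<f(v)$ whenever $u\prec v$ and $u^\downarrow\ne v^\downarrow$. A spectral function $F$ is strictly Schur-convex if its associated symmetric function $f$ is. Local minimizer/maximizer for $x\in\Omega$ means that $\bar x\in\Omega$ and that the optimality inequality holds for all $x\in\Omega$ in some neighborhood of $\bar x$. *)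

theory Defs
  imports "HOL-Analysis.Analysis"
begin

section \<open>Euclidean Jordan algebras\<close>

text \<open>The inner product is the one of \<^class>\<open>euclidean_space\<close>; it is only required to be
  associative, so it need not be the trace inner product. Linearity of the product in the
  right argument follows from commutativity.\<close>

class euclidean_jordan_algebra = euclidean_space +
  fixes jordan_mult :: "'a \<Rightarrow> 'a \<Rightarrow> 'a"  (infixl "\<circ>\<^sub>J" 70)
    and jordan_unit :: 'a
  assumes jordan_mult_add_left: "(x + y) \<circ>\<^sub>J z = x \<circ>\<^sub>J z + y \<circ>\<^sub>J z"
    and jordan_mult_scaleR_left: "(r *\<^sub>R x) \<circ>\<^sub>J y = r *\<^sub>R (x \<circ>\<^sub>J y)"
    and jordan_mult_commute: "x \<circ>\<^sub>J y = y \<circ>\<^sub>J x"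
    and jordan_identity: "(x \<circ>\<^sub>J y) \<circ>\<^sub>J (x \<circ>\<^sub>J x) = x \<circ>\<^sub>J (y \<circ>\<^sub>J (x \<circ>\<^sub>J x))"
    and jordan_unit_mult: "jordan_unit \<circ>\<^sub>J x = x"
    and inner_jordan_mult: "inner (x \<circ>\<^sub>J y) z = inner y (x \<circ>\<^sub>J z)"

definition jordan_idempotent :: "'a::euclidean_jordan_algebra \<Rightarrow> bool" where
  "jordan_idempotent c \<longleftrightarrow> c \<circ>\<^sub>J c = c"

definition primitive_idempotent :: "'a::euclidean_jordan_algebra \<Rightarrow> bool" where
  "primitive_idempotent c \<longleftrightarrow> jordan_idempotent c \<and> c \<noteq> 0 \<and>
     \<not> (\<exists>p q. jordan_idempotent p \<and> p \<noteq> 0 \<and> jordan_idempotent q \<and> q \<noteq> 0 \<and> c = p + q)"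

text \<open>Frames are lists so that eigenvalues can be matched with frame elements by index.
  Distinctness is automatic: \<open>c \<circ>\<^sub>J c = c \<noteq> 0\<close> for every member \<open>c\<close>.\<close>

definition jordan_frame :: "'a::euclidean_jordan_algebra list \<Rightarrow> bool" where
  "jordan_frame es \<longleftrightarrow> (\<forall>c \<in> set es. primitive_idempotent c) \<and> sum_list es = jordan_unit \<and>
     (\<forall>i < length es. \<forall>j < length es. i \<noteq> j \<longrightarrow> es ! i \<circ>\<^sub>J es ! j = 0)"

text \<open>All Jordan frames have the same length, so the description is proper.\<close>

definition jordan_rank :: "'a::euclidean_jordan_algebra itself \<Rightarrow> nat" where
  "jordan_rank _ = (THE n. \<exists>es :: 'a list. jordan_frame es \<and> length es = n)"

definition spectral_decomposition ::
    "'a::euclidean_jordan_algebra \<Rightarrow> real list \<Rightarrow> 'a list \<Rightarrow> bool" where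
  "spectral_decomposition x ls es \<longleftrightarrow> jordan_frame es \<and> length ls = length es \<and>
     x = (\<Sum>i<length es. ls ! i *\<^sub>R es ! i)"

text \<open>The nonincreasing eigenvalue vector \<open>\<lambda>(x) \<in> \<real>\<^sup>n\<close>; by the spectral theorem
  exactly one list satisfies the description.\<close>

definition eigenvalues :: "'a::euclidean_jordan_algebra \<Rightarrow> real list" where
  "eigenvalues x = (THE ls. sorted_wrt (\<ge>) ls \<and> (\<exists>es. spectral_decomposition x ls es))"

definition operator_commute :: "'a::euclidean_jordan_algebra \<Rightarrow> 'a \<Rightarrow> bool" where
  "operator_commute a b \<longleftrightarrow> (\<circ>\<^sub>J) a \<circ> (\<circ>\<^sub>J) b = (\<circ>\<^sub>J) b \<circ> (\<circ>\<^sub>J) a"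

definition jordan_automorphism :: "('a::euclidean_jordan_algebra \<Rightarrow> 'a) \<Rightarrow> bool" where
  "jordan_automorphism A \<longleftrightarrow> linear A \<and> bij A \<and> (\<forall>x y. A (x \<circ>\<^sub>J y) = A x \<circ>\<^sub>J A y)"

definition weakly_spectral :: "'a::euclidean_jordan_algebra set \<Rightarrow> bool" where
  "weakly_spectral \<Omega> \<longleftrightarrow> (\<forall>A. jordan_automorphism A \<longrightarrow> (\<forall>x \<in> \<Omega>. A x \<in> \<Omega>))"


section \<open>Majorization and Schur-convexity\<close>

text \<open>A vector of \<open>\<real>\<^sup>n\<close> is a \<^typ>\<open>real list\<close> of length \<open>n\<close>, as the rank
  depends on the algebra; functions on \<open>\<real>\<^sup>n\<close> are constrained on these lists only.\<close>

definition decr :: "real list \<Rightarrow> real list" where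
  "decr u = rev (sort u)"

definition majorized :: "real list \<Rightarrow> real list \<Rightarrow> bool"  (infix "\<prec>\<^sub>M" 50) where
  "u \<prec>\<^sub>M v \<longleftrightarrow> length u = length v \<and>
     (\<forall>k \<in> {1..length u}. sum_list (take k (decr u)) \<le> sum_list (take k (decr v))) \<and>
     sum_list (decr u) = sum_list (decr v)"

definition symmetric_fun :: "nat \<Rightarrow> (real list \<Rightarrow> real) \<Rightarrow> bool" where
  "symmetric_fun n f \<longleftrightarrow> (\<forall>u v. length u = n \<and> mset u = mset v \<longrightarrow> f u = f v)"

definition strictly_schur_convex :: "nat \<Rightarrow> (real list \<Rightarrow> real) \<Rightarrow> bool" where
  "strictly_schur_convex n f \<longleftrightarrow> (\<forall>u v. length u = n \<and> length v = n \<and> u \<prec>\<^sub>M v \<longrightarrow>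
     f u \<le> f v \<and> (decr u \<noteq> decr v \<longrightarrow> f u < f v))"

definition spectral_function_of ::
    "(real list \<Rightarrow> real) \<Rightarrow> ('a::euclidean_jordan_algebra \<Rightarrow> real) \<Rightarrow> bool" where
  "spectral_function_of f F \<longleftrightarrow>
     symmetric_fun (jordan_rank TYPE('a)) f \<and> (\<forall>x. F x = f (eigenvalues x))"

text \<open>The symmetric function associated with \<open>F\<close> is unique on lists of length the rank,
  so the existential quantifier only names it.\<close>

definition strictly_schur_convex_spectral ::
    "('a::euclidean_jordan_algebra \<Rightarrow> real) \<Rightarrow> bool" where
  "strictly_schur_convex_spectral F \<longleftrightarrow>
     (\<exists>f. spectral_function_of f F \<and> strictly_schur_convex (jordan_rank TYPE('a)) f)"


section \<open>Local optimizers\<close>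

definition local_minimizer ::
    "('a::topological_space \<Rightarrow> real) \<Rightarrow> 'a set \<Rightarrow> 'a \<Rightarrow> bool" where
  "local_minimizer G \<Omega> x0 \<longleftrightarrow>
     x0 \<in> \<Omega> \<and> (\<exists>U. open U \<and> x0 \<in> U \<and> (\<forall>x \<in> \<Omega> \<inter> U. G x0 \<le> G x))"

definition local_maximizer ::
    "('a::topological_space \<Rightarrow> real) \<Rightarrow> 'a set \<Rightarrow> 'a \<Rightarrow> bool" where
  "local_maximizer G \<Omega> x0 \<longleftrightarrow>
     x0 \<in> \<Omega> \<and> (\<exists>U. open U \<and> x0 \<in> U \<and> (\<forall>x \<in> \<Omega> \<inter> U. G x \<le> G x0))"

end

theory Submission
  imports Defs
begin

text \<open>Put \<open>w = x - a\<close> and let \<open>D = [L\<^sub>x, L\<^sub>a]\<close>, a derivation, so that the flow of \<open>x' = D x\<close> stays in the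
  orbit of \<open>x\<close> under automorphisms. In a frame \<open>e\<^sub>1, \<dots>, e\<^sub>n\<close> of \<open>w\<close> with eigenvalues \<open>\<lambda>\<^sub>i\<close>, the \<open>i\<close>-th
  coordinate of \<open>D x\<close> is the sum over \<open>j\<close> of \<open>(\<lambda>\<^sub>i - \<lambda>\<^sub>j) r\<^sub>i\<^sub>j\<close>, where \<open>r\<close> is symmetric and nonnegative off the
  diagonal. By the variational characterisation of sums of the \<open>k\<close> largest eigenvalues, all these
  sums for \<open>w\<close> therefore increase along the flow and decrease along its reversal, while the trace is
  constant; the trace of \<open>w\<^sup>2\<close> changes strictly unless \<open>a\<close> and \<open>x\<close> operator commute. So if they do not,
  arbitrarily small automorphisms move \<open>x - a\<close> strictly up and strictly down in the majorization order.

  The flow itself is not needed: an Euler step \<open>I + hD\<close> is an automorphism and an isometry up to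
  \<open>O(h\<^sup>2)\<close>, and changes the eigenvalue sums in the wrong direction by at most \<open>O(h\<^sup>2)\<close>, so a limit of
  products of \<open>N\<close> steps of size \<open>T/N\<close> is an exact automorphism with the required properties.

  The given inner product need not be the trace form. For primitive \<open>c, d\<close> with \<open>\<langle>c, d\<rangle> \<noteq> 0\<close> one has
  \<open>\<langle>c, c\<rangle> = \<langle>d, d\<rangle>\<close>; hence the matrix \<open>\<langle>e\<^sub>i, f\<^sub>j\<rangle> / \<langle>e\<^sub>i, e\<^sub>i\<rangle>\<close> of two frames is doubly stochastic, which gives
  the invariance of the rank, the uniqueness of eigenvalues, the variational characterisation and
  the linearity of the trace.\<close>

section \<open>Bilinearity of the Jordan product\<close>

lemma jordan_mult_add_right: "z \<circ>\<^sub>J (x + y) = z \<circ>\<^sub>J x + z \<circ>\<^sub>J y" for x :: "'a::euclidean_jordan_algebra"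
  by (metis jordan_mult_add_left jordan_mult_commute)

lemma jordan_mult_scaleR_right: "x \<circ>\<^sub>J (r *\<^sub>R y) = r *\<^sub>R (x \<circ>\<^sub>J y)" for x :: "'a::euclidean_jordan_algebra"
  by (metis jordan_mult_scaleR_left jordan_mult_commute)

interpretation jordan_mult: bounded_bilinear "jordan_mult :: 'a::euclidean_jordan_algebra \<Rightarrow> 'a \<Rightarrow> 'a"
proof -
  have "bilinear (jordan_mult :: 'a \<Rightarrow> 'a \<Rightarrow> 'a)"
    unfolding bilinear_def
    by (auto intro!: linearI simp: jordan_mult_add_left jordan_mult_scaleR_left
        jordan_mult_add_right jordan_mult_scaleR_right)
  then show "bounded_bilinear (jordan_mult :: 'a \<Rightarrow> 'a \<Rightarrow> 'a)"
    by (simp add: bilinear_conv_bounded_bilinear)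
qed

lemmas jordan_simps = jordan_mult.add_left jordan_mult.add_right
  jordan_mult.diff_left jordan_mult.diff_right jordan_mult.scaleR_left jordan_mult.scaleR_right
  jordan_mult.minus_left jordan_mult.minus_right

declare jordan_mult.zero_left [simp] jordan_mult.zero_right [simp]

lemma jordan_mult_unit [simp]: "x \<circ>\<^sub>J jordan_unit = x" for x :: "'a::euclidean_jordan_algebra"
  by (metis jordan_mult_commute jordan_unit_mult)

lemma operator_commute_iff: "operator_commute a b \<longleftrightarrow> (\<forall>y. a \<circ>\<^sub>J (b \<circ>\<^sub>J y) = b \<circ>\<^sub>J (a \<circ>\<^sub>J y))"
  by (auto simp: operator_commute_def fun_eq_iff)

section \<open>Linearisations of the Jordan identity\<close>

text \<open>For fixed \<open>d\<close> the failure of the identity is a trilinear form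
  \<open>f\<close>, symmetric in its last two arguments and zero on the diagonal by the Jordan
  identity. Inclusion-exclusion over sums of a, b, c isolates twice its cyclic sum.\<close>

lemma jordan_identity_polarized:
  fixes a b c d :: "'a::euclidean_jordan_algebra"
  shows "a \<circ>\<^sub>J ((b \<circ>\<^sub>J c) \<circ>\<^sub>J d) + b \<circ>\<^sub>J ((c \<circ>\<^sub>J a) \<circ>\<^sub>J d) + c \<circ>\<^sub>J ((a \<circ>\<^sub>J b) \<circ>\<^sub>J d) =
         (b \<circ>\<^sub>J c) \<circ>\<^sub>J (a \<circ>\<^sub>J d) + (c \<circ>\<^sub>J a) \<circ>\<^sub>J (b \<circ>\<^sub>J d) + (a \<circ>\<^sub>J b) \<circ>\<^sub>J (c \<circ>\<^sub>J d)"
proof -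
  define f where "f x y z = x \<circ>\<^sub>J ((y \<circ>\<^sub>J z) \<circ>\<^sub>J d) - (y \<circ>\<^sub>J z) \<circ>\<^sub>J (x \<circ>\<^sub>J d)" for x y z
  have f0: "f x x x = 0" for x
    using jordan_identity[of x d] unfolding f_def
    by (metis jordan_mult_commute cancel_comm_monoid_add_class.diff_cancel)
  have fs: "f x y z = f x z y" for x y z
    by (simp add: f_def jordan_mult_commute)
  have fa: "f (x + x') y z = f x y z + f x' y z" "f x (y + y') z = f x y z + f x y' z"
     "f x y (z + z') = f x y z + f x y z'" for x x' y y' z z'
    by (simp_all add: f_def jordan_simps)
  have "f (a+b+c) (a+b+c) (a+b+c) - f (a+b) (a+b) (a+b) - f (b+c) (b+c) (b+c) - f (a+c) (a+c) (a+c)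
     + f a a a + f b b b + f c c c = 2 *\<^sub>R (f a b c + f b c a + f c a b)"
    unfolding fa scaleR_2 using fs[of a c b] fs[of b c a] fs[of c b a] by simp
  then have "f a b c + f b c a + f c a b = 0"
    by (simp add: f0)
  then show ?thesis by (simp add: f_def algebra_simps)
qed

text \<open>The polarised identity with \<open>y\<close> in one of the cyclic slots, solved for the
  term in which \<open>y\<close> stands outside. It reduces multiplication by a triple product to
  multiplications by shorter products.\<close>

lemma jordan_mult_triple:
  fixes b c d y :: "'a::euclidean_jordan_algebra"
  shows "((b \<circ>\<^sub>J c) \<circ>\<^sub>J d) \<circ>\<^sub>J y = (b \<circ>\<^sub>J c) \<circ>\<^sub>J (d \<circ>\<^sub>J y) + (b \<circ>\<^sub>J d) \<circ>\<^sub>J (c \<circ>\<^sub>J y) + (c \<circ>\<^sub>J d) \<circ>\<^sub>J (b \<circ>\<^sub>J y)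
     - b \<circ>\<^sub>J (d \<circ>\<^sub>J (c \<circ>\<^sub>J y)) - c \<circ>\<^sub>J (d \<circ>\<^sub>J (b \<circ>\<^sub>J y))"
proof -
  have "y \<circ>\<^sub>J ((b \<circ>\<^sub>J c) \<circ>\<^sub>J d) + b \<circ>\<^sub>J ((c \<circ>\<^sub>J y) \<circ>\<^sub>J d) + c \<circ>\<^sub>J ((y \<circ>\<^sub>J b) \<circ>\<^sub>J d) =
         (b \<circ>\<^sub>J c) \<circ>\<^sub>J (y \<circ>\<^sub>J d) + (c \<circ>\<^sub>J y) \<circ>\<^sub>J (b \<circ>\<^sub>J d) + (y \<circ>\<^sub>J b) \<circ>\<^sub>J (c \<circ>\<^sub>J d)"
    by (rule jordan_identity_polarized)
  then have "y \<circ>\<^sub>J ((b \<circ>\<^sub>J c) \<circ>\<^sub>J d) = (b \<circ>\<^sub>J c) \<circ>\<^sub>J (y \<circ>\<^sub>J d) + (c \<circ>\<^sub>J y) \<circ>\<^sub>J (b \<circ>\<^sub>J d) + (y \<circ>\<^sub>J b) \<circ>\<^sub>J (c \<circ>\<^sub>J d)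
    - b \<circ>\<^sub>J ((c \<circ>\<^sub>J y) \<circ>\<^sub>J d) - c \<circ>\<^sub>J ((y \<circ>\<^sub>J b) \<circ>\<^sub>J d)"
    by (simp add: algebra_simps)
  then show ?thesis by (simp add: jordan_mult_commute)
qed

text \<open>Exchanging \<open>a\<close> and \<open>d\<close> leaves the right-hand side of the
  polarised identity unchanged, so the two left-hand sides agree.\<close>

lemma jordan_commutator_derivation:
  fixes a d c b :: "'a::euclidean_jordan_algebra"
  shows "a \<circ>\<^sub>J (d \<circ>\<^sub>J (b \<circ>\<^sub>J c)) - d \<circ>\<^sub>J (a \<circ>\<^sub>J (b \<circ>\<^sub>J c)) =
     (a \<circ>\<^sub>J (d \<circ>\<^sub>J b) - d \<circ>\<^sub>J (a \<circ>\<^sub>J b)) \<circ>\<^sub>J c + b \<circ>\<^sub>J (a \<circ>\<^sub>J (d \<circ>\<^sub>J c) - d \<circ>\<^sub>J (a \<circ>\<^sub>J c))"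
proof -
  note jordan_identity_polarized[of a b c d]
  moreover note jordan_identity_polarized[of d b c a]
  ultimately have "a \<circ>\<^sub>J (d \<circ>\<^sub>J (b \<circ>\<^sub>J c)) + b \<circ>\<^sub>J (d \<circ>\<^sub>J (a \<circ>\<^sub>J c)) + c \<circ>\<^sub>J (d \<circ>\<^sub>J (a \<circ>\<^sub>J b))
    = d \<circ>\<^sub>J (a \<circ>\<^sub>J (b \<circ>\<^sub>J c)) + b \<circ>\<^sub>J (a \<circ>\<^sub>J (d \<circ>\<^sub>J c)) + c \<circ>\<^sub>J (a \<circ>\<^sub>J (d \<circ>\<^sub>J b))"
    by (simp add: jordan_mult_commute add_ac)
  then show ?thesis
    by (simp add: jordan_simps jordan_mult_commute algebra_simps)
qed

section \<open>Idempotents\<close>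

text \<open>The triple product formula with all three factors equal to \<open>c\<close>. The roots
  of 2t^3 - 3t^2 + t are the Peirce eigenvalues 0, 1/2, 1.\<close>

lemma peirce_cubic:
  fixes c y :: "'a::euclidean_jordan_algebra"
  assumes "c \<circ>\<^sub>J c = c"
  shows "2 *\<^sub>R (c \<circ>\<^sub>J (c \<circ>\<^sub>J (c \<circ>\<^sub>J y))) = 3 *\<^sub>R (c \<circ>\<^sub>J (c \<circ>\<^sub>J y)) - c \<circ>\<^sub>J y"
proof -
  have "3 *\<^sub>R v = v + v + v" for v :: 'a
    by (metis numeral_Bit1 numeral_One scaleR_add_left scaleR_one)
  then show ?thesis
    using jordan_mult_triple[of c c c y] assms by (simp add: scaleR_2 algebra_simps)
qed

text \<open>Polarised identity with arguments c, c, d: all terms containing c \<circ> d drop out.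
  Here \<open>d\<close> may be any element of the Peirce 0-space of \<open>c\<close>.\<close>

lemma orthogonal_idempotent_commute:
  fixes c d y :: "'a::euclidean_jordan_algebra"
  assumes "c \<circ>\<^sub>J c = c" "c \<circ>\<^sub>J d = 0"
  shows "c \<circ>\<^sub>J (d \<circ>\<^sub>J y) = d \<circ>\<^sub>J (c \<circ>\<^sub>J y)"
  using jordan_identity_polarized[of c c d y] assms
  by (simp add: jordan_mult_commute[of d c])

lemma peirce_one_commute:
  fixes c x y :: "'a::euclidean_jordan_algebra"
  assumes "c \<circ>\<^sub>J c = c" "c \<circ>\<^sub>J x = x"
  shows "c \<circ>\<^sub>J (x \<circ>\<^sub>J y) = x \<circ>\<^sub>J (c \<circ>\<^sub>J y)"
  using jordan_identity_polarized[of c c x y] assms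
  by (simp add: jordan_mult_commute[of x c])

text \<open>The hypothesis on \<open>x\<close> says that it has no Peirce 1/2-component, so
  \<open>x\<close> splits into a part in the 1-space and a part in the 0-space, each of which
  commutes with \<open>c\<close>.\<close>

lemma peirce_diagonal_commute:
  fixes c x y :: "'a::euclidean_jordan_algebra"
  assumes c: "c \<circ>\<^sub>J c = c" and x: "c \<circ>\<^sub>J (c \<circ>\<^sub>J x) = c \<circ>\<^sub>J x"
  shows "c \<circ>\<^sub>J (x \<circ>\<^sub>J y) = x \<circ>\<^sub>J (c \<circ>\<^sub>J y)"
proof -
  have 1: "c \<circ>\<^sub>J ((c \<circ>\<^sub>J x) \<circ>\<^sub>J y) = (c \<circ>\<^sub>J x) \<circ>\<^sub>J (c \<circ>\<^sub>J y)"
    by (rule peirce_one_commute[OF c x])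
  have 2: "c \<circ>\<^sub>J ((x - c \<circ>\<^sub>J x) \<circ>\<^sub>J y) = (x - c \<circ>\<^sub>J x) \<circ>\<^sub>J (c \<circ>\<^sub>J y)"
    by (rule orthogonal_idempotent_commute[OF c]) (simp add: jordan_simps x)
  show ?thesis using 1 2 by (simp add: jordan_simps)
qed

text \<open>On the Peirce eigenvalues 0, 1/2, 1 one has \<open>t = (2t\<^sup>2 - t)\<^sup>2 + (4t - 4t\<^sup>2)\<^sup>2 / 2\<close>,
  which writes \<open>L\<^sub>c\<close> as a sum of squares of polynomials in itself.\<close>

lemma idempotent_psd_commuting:
  fixes c y :: "'a::euclidean_jordan_algebra" and B :: "'a \<Rightarrow> 'a"
  assumes c: "c \<circ>\<^sub>J c = c" and B: "linear B" "\<And>y. B (c \<circ>\<^sub>J y) = c \<circ>\<^sub>J B y"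
    and pos: "\<And>y. 0 \<le> inner y (B y)"
  shows "0 \<le> inner (c \<circ>\<^sub>J y) (B y)"
proof -
  define P where "P y = 2 *\<^sub>R (c \<circ>\<^sub>J (c \<circ>\<^sub>J y)) - c \<circ>\<^sub>J y" for y
  define H where "H y = 4 *\<^sub>R (c \<circ>\<^sub>J y - c \<circ>\<^sub>J (c \<circ>\<^sub>J y))" for y
  note Bl = linear_diff[OF B(1)] linear_cmul[OF B(1)] linear_add[OF B(1)]
  have cub: "c \<circ>\<^sub>J (c \<circ>\<^sub>J (c \<circ>\<^sub>J y)) = (3/2) *\<^sub>R (c \<circ>\<^sub>J (c \<circ>\<^sub>J y)) - (1/2) *\<^sub>R (c \<circ>\<^sub>J y)" for y
  proof -
    have "(1/2) *\<^sub>R (2 *\<^sub>R (c \<circ>\<^sub>J (c \<circ>\<^sub>J (c \<circ>\<^sub>J y)))) = (1/2) *\<^sub>R (3 *\<^sub>R (c \<circ>\<^sub>J (c \<circ>\<^sub>J y)) - c \<circ>\<^sub>J y)"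
      by (simp only: peirce_cubic[OF c])
    then show ?thesis by (simp add: scaleR_right_diff_distrib)
  qed
  have dec: "c \<circ>\<^sub>J y = P (P y) + (1/2) *\<^sub>R H (H y)"
    by (subst vector_eq_rdot[symmetric]) (simp add: P_def H_def jordan_simps cub inner_simps, simp add: field_simps)
  have Psym: "inner (P u) v = inner u (P v)" for u v
    by (simp add: P_def inner_diff inner_jordan_mult)
  have Hsym: "inner (H u) v = inner u (H v)" for u v
    by (simp add: H_def inner_diff inner_jordan_mult)
  have "inner (c \<circ>\<^sub>J y) (B y) = inner (P y) (P (B y)) + (1/2) * inner (H y) (H (B y))"
    by (simp add: dec inner_add Psym Hsym)
  also have "P (B y) = B (P y)" by (simp add: P_def Bl B)
  also have "H (B y) = B (H y)" by (simp add: H_def Bl B)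
  finally show ?thesis using pos[of "P y"] pos[of "H y"] by simp
qed

lemma idempotent_psd:
  fixes c y :: "'a::euclidean_jordan_algebra"
  assumes "c \<circ>\<^sub>J c = c"
  shows "0 \<le> inner (c \<circ>\<^sub>J y) y"
  using idempotent_psd_commuting[OF assms linear_id] by simp

lemma orthogonal_idempotents_psd:
  fixes c d y :: "'a::euclidean_jordan_algebra"
  assumes "c \<circ>\<^sub>J c = c" "d \<circ>\<^sub>J d = d" "c \<circ>\<^sub>J d = 0"
  shows "0 \<le> inner (c \<circ>\<^sub>J y) (d \<circ>\<^sub>J y)"
proof (rule idempotent_psd_commuting[OF assms(1)])
  show "linear ((\<circ>\<^sub>J) d)"
    by (rule linearI) (simp_all add: jordan_simps)
  show "d \<circ>\<^sub>J (c \<circ>\<^sub>J y) = c \<circ>\<^sub>J (d \<circ>\<^sub>J y)" for y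
    using orthogonal_idempotent_commute[OF assms(1,3)] by simp
  show "0 \<le> inner y (d \<circ>\<^sub>J y)" for y
    using idempotent_psd[OF assms(2)] by (simp add: inner_commute)
qed

text \<open>Along u + t f(u), which stays in \<open>S\<close>, the quadratic form equals 2tp + t^2 q
  with p the squared norm of f(u). Nonnegativity for all real t forces p = 0.\<close>

lemma psd_kernel:
  fixes f :: "'a::real_inner \<Rightarrow> 'a"
  assumes f: "linear f" and sym: "\<And>u v. inner (f u) v = inner u (f v)"
    and S: "subspace S" and pos: "\<And>u. u \<in> S \<Longrightarrow> 0 \<le> inner u (f u)"
    and u: "u \<in> S" "f u \<in> S" and zero: "inner u (f u) = 0"
  shows "f u = 0"
proof -
  define p q where "p = inner (f u) (f u)" and "q = inner (f u) (f (f u))"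
  have q: "q \<ge> 0" unfolding q_def using pos u by simp
  have ge: "0 \<le> 2 * t * p + t\<^sup>2 * q" for t
    using pos[of "u + t *\<^sub>R f u"] u S zero sym[of u "f u"] unfolding p_def q_def
    by (simp add: subspace_add subspace_scale linear_add[OF f] linear_cmul[OF f] inner_add
        algebra_simps power2_eq_square inner_commute)
  have "p = 0"
  proof (rule ccontr)
    assume "p \<noteq> 0"
    then have p: "p > 0" by (simp add: p_def)
    define r where "r = p\<^sup>2 / (q + 1)"
    have r: "r > 0" using p q by (simp add: r_def)
    \<comment> \<open>The minimising t would be -p/q; the denominator q + 1 also covers q =
      0.\<close>
    have "0 \<le> - 2 * r + r * (q / (q + 1))"
      using ge[of "- p / (q + 1)"] by (simp add: r_def power2_eq_square)
    also have "r * (q / (q + 1)) \<le> r * 1"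
      using r q by (intro mult_left_mono) auto
    finally show False using r by simp
  qed
  then show ?thesis by (simp add: p_def)
qed

section \<open>The spectral theorem\<close>

text \<open>A maximiser \<open>v\<close> of the Rayleigh quotient on the unit sphere of
  \<open>S\<close> makes r id - f positive semidefinite on \<open>S\<close> with vanishing form at
  \<open>v\<close>, so \<open>psd_kernel\<close> applies.\<close>

lemma self_adjoint_eigenvector:
  fixes f :: "'a::euclidean_space \<Rightarrow> 'a"
  assumes f: "linear f" and sym: "\<And>u v. inner (f u) v = inner u (f v)"
    and S: "subspace S" and inv: "\<And>u. u \<in> S \<Longrightarrow> f u \<in> S" and ne: "w \<in> S" "w \<noteq> 0"
  obtains v r where "v \<in> S" "v \<noteq> 0" "f v = r *\<^sub>R v"
proof -
  let ?K = "S \<inter> sphere 0 1"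
  have "compact ?K" by (simp add: closed_Int_compact closed_subspace S)
  moreover have "(1 / norm w) *\<^sub>R w \<in> ?K" using ne S by (simp add: subspace_scale)
  moreover have "continuous_on ?K (\<lambda>v. inner (f v) v)"
    by (intro continuous_intros linear_continuous_on linear_conv_bounded_linear[THEN iffD1] f)
  ultimately obtain v where v: "v \<in> ?K" and max: "\<And>u. u \<in> ?K \<Longrightarrow> inner (f u) u \<le> inner (f v) v"
    using continuous_attains_sup[of ?K "\<lambda>v. inner (f v) v"] by blast
  define r where "r = inner (f v) v"
  have vv: "inner v v = 1" using v by (simp add: norm_eq_1)
  define g where "g u = r *\<^sub>R u - f u" for u
  have g: "linear g" unfolding g_def by (intro linear_compose_sub f linear_scale_self)
  have psd: "0 \<le> inner u (g u)" if "u \<in> S" for u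
  proof (cases "u = 0")
    case False
    then have "(1 / norm u) *\<^sub>R u \<in> ?K" using that S by (simp add: subspace_scale)
    from max[OF this] have "inner (f u) u / (norm u * norm u) \<le> r"
      by (simp add: linear_cmul[OF f] r_def)
    then have "inner (f u) u \<le> r * inner u u"
      using False by (simp add: divide_simps dot_square_norm power2_eq_square mult_ac)
    then show ?thesis by (simp add: g_def inner_diff inner_commute)
  qed (simp add: g_def)
  have zero: "inner v (g v) = 0" using vv by (simp add: g_def inner_diff inner_commute r_def)
  have "v \<in> S" "g v \<in> S" using v inv S by (simp_all add: g_def subspace_diff subspace_scale)
  moreover have "inner (g x) y = inner x (g y)" for x y
    by (simp add: g_def inner_diff sym)
  ultimately have "g v = 0"
    using psd_kernel[OF g _ S psd] zero by blast
  then have "f v = r *\<^sub>R v" by (simp add: g_def)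
  then show thesis using that[of v r] v by force
qed

section \<open>The associative algebra generated by one element\<close>

text \<open>The zeroth power is \<open>c\<close>: powers are taken in the Peirce subalgebra whose
  unit is \<open>c\<close>.\<close>

primrec jordan_power :: "'a::euclidean_jordan_algebra \<Rightarrow> 'a \<Rightarrow> nat \<Rightarrow> 'a" where
  "jordan_power c x 0 = c"
| "jordan_power c x (Suc n) = x \<circ>\<^sub>J jordan_power c x n"

text \<open>By \<open>jordan_mult_triple\<close>, multiplication by the power n + 2 is a polynomial
  in multiplications by x, x \<circ> x and the powers n and n + 1. Whatever commutes with the latter
  commutes with the former, by an induction that reaches back two steps.\<close>

lemma jordan_power_commutant:
  fixes c x :: "'a::euclidean_jordan_algebra" and B :: "'a \<Rightarrow> 'a"
  assumes x: "c \<circ>\<^sub>J x = x" and B: "linear B"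
    and Bc: "\<And>y. B (c \<circ>\<^sub>J y) = c \<circ>\<^sub>J B y" and Bx: "\<And>y. B (x \<circ>\<^sub>J y) = x \<circ>\<^sub>J B y"
    and Bxx: "\<And>y. B ((x \<circ>\<^sub>J x) \<circ>\<^sub>J y) = (x \<circ>\<^sub>J x) \<circ>\<^sub>J B y"
  shows "B (jordan_power c x n \<circ>\<^sub>J y) = jordan_power c x n \<circ>\<^sub>J B y"
proof (induction n arbitrary: y rule: induct_nat_012)
  case 0 show ?case by (simp add: Bc)
next
  case 1 show ?case using Bx x by (simp add: jordan_mult_commute[of x c])
next
  case (ge2 n)
  let ?p = "jordan_power c x n"
  have "jordan_power c x (Suc (Suc n)) \<circ>\<^sub>J z = (x \<circ>\<^sub>J ?p) \<circ>\<^sub>J (x \<circ>\<^sub>J z) + (x \<circ>\<^sub>J x) \<circ>\<^sub>J (?p \<circ>\<^sub>J z)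
     + (x \<circ>\<^sub>J ?p) \<circ>\<^sub>J (x \<circ>\<^sub>J z) - x \<circ>\<^sub>J (x \<circ>\<^sub>J (?p \<circ>\<^sub>J z)) - ?p \<circ>\<^sub>J (x \<circ>\<^sub>J (x \<circ>\<^sub>J z))" for z
    using jordan_mult_triple[of x ?p x z] by (simp add: jordan_mult_commute)
  then show ?case
    using ge2.IH by (simp add: linear_add[OF B] linear_diff[OF B] Bx Bxx)
qed

definition power_span :: "'a::euclidean_jordan_algebra \<Rightarrow> 'a \<Rightarrow> 'a set" where
  "power_span c x = span (range (jordan_power c x))"

lemma subspace_power_span: "subspace (power_span c x)"
  by (simp add: power_span_def)

lemma linear_jordan_mult: "linear ((\<circ>\<^sub>J) u)" for u :: "'a::euclidean_jordan_algebra"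
  by (rule linearI) (simp_all add: jordan_simps)

context
  fixes c x :: "'a::euclidean_jordan_algebra"
  assumes c: "c \<circ>\<^sub>J c = c" and x: "c \<circ>\<^sub>J x = x"
begin

text \<open>The commutant lemma is used in two rounds: first multiplications by c, x and x \<circ> x
  are shown to commute with every power, then multiplication by a power itself takes the role of
  \<open>B\<close>. That x and x \<circ> x operator commute is the Jordan identity.\<close>

lemma jordan_power_commute:
  "jordan_power c x m \<circ>\<^sub>J (jordan_power c x n \<circ>\<^sub>J y) = jordan_power c x n \<circ>\<^sub>J (jordan_power c x m \<circ>\<^sub>J y)"
proof -
  have cx: "c \<circ>\<^sub>J (x \<circ>\<^sub>J y) = x \<circ>\<^sub>J (c \<circ>\<^sub>J y)" for y
    using peirce_one_commute[OF c x] .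
  have cxx: "c \<circ>\<^sub>J ((x \<circ>\<^sub>J x) \<circ>\<^sub>J y) = (x \<circ>\<^sub>J x) \<circ>\<^sub>J (c \<circ>\<^sub>J y)" for y
    by (rule peirce_one_commute[OF c]) (simp add: cx x)
  have xxx: "x \<circ>\<^sub>J ((x \<circ>\<^sub>J x) \<circ>\<^sub>J y) = (x \<circ>\<^sub>J x) \<circ>\<^sub>J (x \<circ>\<^sub>J y)" for y
    by (metis jordan_identity jordan_mult_commute)
  note comm = jordan_power_commutant[OF x linear_jordan_mult]
  have 1: "c \<circ>\<^sub>J (jordan_power c x n \<circ>\<^sub>J y) = jordan_power c x n \<circ>\<^sub>J (c \<circ>\<^sub>J y)" for n y
    by (rule comm) (simp_all add: cx cxx)
  have 2: "x \<circ>\<^sub>J (jordan_power c x n \<circ>\<^sub>J y) = jordan_power c x n \<circ>\<^sub>J (x \<circ>\<^sub>J y)" for n y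
    by (rule comm) (simp_all add: cx xxx)
  have 3: "(x \<circ>\<^sub>J x) \<circ>\<^sub>J (jordan_power c x n \<circ>\<^sub>J y) = jordan_power c x n \<circ>\<^sub>J ((x \<circ>\<^sub>J x) \<circ>\<^sub>J y)" for n y
    by (rule comm) (simp_all add: cxx xxx)
  show ?thesis by (rule comm) (simp_all add: 1 2 3)
qed

lemma jordan_power_unit: "c \<circ>\<^sub>J jordan_power c x n = jordan_power c x n"
  by (induction n) (simp_all add: c x peirce_one_commute[OF c x])

lemma jordan_power_mult_arg: "x \<circ>\<^sub>J (jordan_power c x n \<circ>\<^sub>J y) = jordan_power c x n \<circ>\<^sub>J (x \<circ>\<^sub>J y)"
  using jordan_power_commute[of 1 n] x by (simp add: jordan_mult_commute[of x c])

lemma jordan_power_add: "jordan_power c x m \<circ>\<^sub>J jordan_power c x n = jordan_power c x (m + n)"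
  by (induction n)
    (simp_all add: jordan_mult_commute[of _ c] jordan_power_unit flip: jordan_power_mult_arg)

lemma power_span_mult:
  assumes "u \<in> power_span c x" "v \<in> power_span c x"
  shows "u \<circ>\<^sub>J v \<in> power_span c x"
proof -
  have 1: "jordan_power c x m \<circ>\<^sub>J v \<in> power_span c x" for m
    using assms(2) unfolding power_span_def
  proof (induction rule: span_induct_alt)
    case (step r w y)
    then show ?case
      by (auto simp: jordan_simps jordan_power_add intro!: span_add[OF span_scale[OF span_base]])
  qed (simp add: span_zero)
  show ?thesis
    using assms(1) unfolding power_span_def
  proof (induction rule: span_induct_alt)
    case (step r w y)
    then show ?case
      using 1 unfolding power_span_def by (auto simp: jordan_simps intro!: span_add span_scale)
  qed (simp add: span_zero)
qed

lemma power_span_commute: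
  assumes "u \<in> power_span c x" "v \<in> power_span c x"
  shows "u \<circ>\<^sub>J (v \<circ>\<^sub>J y) = v \<circ>\<^sub>J (u \<circ>\<^sub>J y)"
proof -
  have 1: "jordan_power c x m \<circ>\<^sub>J (v \<circ>\<^sub>J y) = v \<circ>\<^sub>J (jordan_power c x m \<circ>\<^sub>J y)" for m
    using assms(2) unfolding power_span_def
    by (induction rule: span_induct_alt) (auto simp: jordan_simps jordan_power_commute[of m])
  show ?thesis
    using assms(1) unfolding power_span_def
    by (induction rule: span_induct_alt) (auto simp: jordan_simps 1)
qed

lemma power_span_unit: "u \<in> power_span c x \<Longrightarrow> c \<circ>\<^sub>J u = u"
  unfolding power_span_def
  by (induction rule: span_induct_alt) (auto simp: jordan_simps jordan_power_unit)

text \<open>\<open>u\<close> is a polynomial in \<open>x\<close>, so r is that polynomial evaluated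
  at \<open>l\<close>. Applied with u = v, this makes an eigenvector proportional to its own
  square.\<close>

lemma power_span_eigen:
  assumes "u \<in> power_span c x" "v \<in> power_span c x" "x \<circ>\<^sub>J v = l *\<^sub>R v"
  shows "\<exists>r. u \<circ>\<^sub>J v = r *\<^sub>R v"
proof -
  have 1: "jordan_power c x m \<circ>\<^sub>J v = l ^ m *\<^sub>R v" for m
  proof (induction m)
    case (Suc m)
    have "jordan_power c x (Suc m) \<circ>\<^sub>J v = jordan_power c x m \<circ>\<^sub>J (x \<circ>\<^sub>J v)"
    proof -
      have "jordan_power c x (Suc m) \<circ>\<^sub>J v = v \<circ>\<^sub>J (x \<circ>\<^sub>J jordan_power c x m)"
        by (simp add: jordan_mult_commute)
      also have "\<dots> = x \<circ>\<^sub>J (v \<circ>\<^sub>J jordan_power c x m)"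
        using power_span_commute[OF assms(2), of x] span_base[of x "range (jordan_power c x)"]
        by (metis c jordan_mult_commute jordan_power.simps power_span_def rangeI x)
      finally show ?thesis by (metis jordan_power_mult_arg jordan_mult_commute)
    qed
    then show ?case by (simp add: assms(3) jordan_simps Suc mult_ac)
  qed (simp add: power_span_unit assms(2))
  show ?thesis
    using assms(1) unfolding power_span_def
  proof (induction rule: span_induct_alt)
    case base
    show ?case by (rule exI[of _ 0]) simp
  next
    case (step r w y)
    then obtain m s where "w = jordan_power c x m" "y \<circ>\<^sub>J v = s *\<^sub>R v" by blast
    then show ?case
      by (intro exI[of _ "r * l ^ m + s"]) (simp add: jordan_simps 1 scaleR_add_left)
  qed
qed

lemma power_span_contains: "c \<in> power_span c x" "x \<in> power_span c x"
proof -
  have "jordan_power c x 0 \<in> power_span c x" "jordan_power c x 1 \<in> power_span c x"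
    unfolding power_span_def by (intro span_base rangeI)+
  then show "c \<in> power_span c x" "x \<in> power_span c x"
    by (simp_all add: jordan_mult_commute[of x c] x)
qed

end

section \<open>Systems of orthogonal idempotents\<close>

definition orthogonal_idempotents :: "'a::euclidean_jordan_algebra set \<Rightarrow> bool" where
  "orthogonal_idempotents C \<longleftrightarrow> finite C \<and> (\<forall>d\<in>C. d \<circ>\<^sub>J d = d \<and> d \<noteq> 0) \<and>
     (\<forall>d\<in>C. \<forall>d'\<in>C. d \<noteq> d' \<longrightarrow> d \<circ>\<^sub>J d' = 0)"

lemma orthogonal_idempotents_inner:
  fixes c d :: "'a::euclidean_jordan_algebra"
  assumes "c \<circ>\<^sub>J d = 0" "c \<circ>\<^sub>J c = c"
  shows "inner c d = 0"
  using inner_jordan_mult[of c c d] assms by simp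

text \<open>Nonzero pairwise orthogonal vectors are independent. The bound guarantees systems of
  greatest cardinality, on which both spectral decompositions below rest.\<close>

lemma card_orthogonal_idempotents:
  fixes C :: "'a::euclidean_jordan_algebra set"
  assumes "orthogonal_idempotents C" shows "card C \<le> DIM('a)"
proof -
  have "pairwise orthogonal C" "0 \<notin> C"
    using assms unfolding orthogonal_idempotents_def pairwise_def orthogonal_def
    by (auto intro: orthogonal_idempotents_inner)
  then show ?thesis
    using pairwise_orthogonal_independent independent_bound by blast
qed

lemma sum_orthogonal_idempotents:
  assumes C: "orthogonal_idempotents C" and d: "d \<in> C"
  shows "(\<Sum>C) \<circ>\<^sub>J d = d"
proof -
  have "(\<Sum>C) \<circ>\<^sub>J d = (\<Sum>c\<in>C. if c = d then d else 0)"
    using C d unfolding orthogonal_idempotents_def jordan_mult.sum_left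
    by (intro sum.cong) auto
  then show ?thesis using C d by (simp add: orthogonal_idempotents_def)
qed

text \<open>The unit is allowed to be replaced by any idempotent \<open>c\<close>, so that the result applies to the
  Peirce subalgebra of \<open>c\<close>.\<close>

lemma spectral_idempotents:
  fixes c x :: "'a::euclidean_jordan_algebra"
  assumes c: "c \<circ>\<^sub>J c = c" and x: "c \<circ>\<^sub>J x = x"
  obtains C l where "orthogonal_idempotents C" "\<Sum>C = c" "x = (\<Sum>d\<in>C. l d *\<^sub>R d)"
proof -
  let ?W = "power_span c x"
  note sub = subspace_power_span[of c x]
  note Wc = power_span_contains(1)[OF c x] and Wx = power_span_contains(2)[OF c x]
  note Wmult = power_span_mult[OF c x] and comm = power_span_commute[OF c x]
    and unit = power_span_unit[OF c x]
  \<comment> \<open>A largest orthogonal system of idempotent eigenvectors of x inside the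
    associative algebra will turn out to sum to \<open>c\<close>.\<close>
  define good where "good C \<longleftrightarrow> orthogonal_idempotents C \<and> C \<subseteq> ?W \<and> (\<forall>d\<in>C. \<exists>l. x \<circ>\<^sub>J d = l *\<^sub>R d)" for C
  have "good {}" by (simp add: good_def orthogonal_idempotents_def)
  moreover have "card C < Suc DIM('a)" if "good C" for C
    using that card_orthogonal_idempotents[of C] by (simp add: good_def)
  ultimately obtain C where C: "good C" and max: "\<And>C'. good C' \<Longrightarrow> card C' \<le> card C"
    using ex_has_greatest_nat[of good "{}" card "Suc DIM('a)"] by blast
  have CW: "C \<subseteq> ?W" and oC: "orthogonal_idempotents C" using C by (auto simp: good_def)
  define e where "e = c - \<Sum>C"
  have eW: "e \<in> ?W" unfolding e_def using CW sub Wc by (auto intro: subspace_diff subspace_sum)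
  have eC: "e \<circ>\<^sub>J d = 0" if "d \<in> C" for d
    using sum_orthogonal_idempotents[OF oC that] unit[of d] that CW by (auto simp: e_def jordan_simps)
  \<comment> \<open>Otherwise x has an eigenvector in e \<circ> W, and a multiple of it is an
    idempotent orthogonal to \<open>C\<close>, contradicting maximality.\<close>
  have "e = 0"
  proof (rule ccontr)
    assume e: "e \<noteq> 0"
    let ?S = "(\<circ>\<^sub>J) e ` ?W"
    have ec: "e \<circ>\<^sub>J c = e" using unit[OF eW] by (simp add: jordan_mult_commute)
    have "subspace ?S" using sub by (rule linear_subspace_image[OF linear_jordan_mult])
    moreover have "x \<circ>\<^sub>J u \<in> ?S" if "u \<in> ?S" for u
      using that comm[OF Wx eW] Wmult[OF Wx] by auto
    moreover have "e \<in> ?S" using ec Wc by force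
    ultimately obtain v l where v: "v \<in> ?S" "v \<noteq> 0" "x \<circ>\<^sub>J v = l *\<^sub>R v"
      using self_adjoint_eigenvector[OF linear_jordan_mult, of x ?S e] e by (metis inner_jordan_mult)
    then obtain u where u: "u \<in> ?W" "v = e \<circ>\<^sub>J u" by blast
    have vW: "v \<in> ?W" using u Wmult eW by blast
    obtain r where r: "v \<circ>\<^sub>J v = r *\<^sub>R v"
      using power_span_eigen[OF c x vW vW v(3)] by blast
    \<comment> \<open>A nonzero \<open>v\<close> cannot have square zero, which permits the
      normalisation by 1/r.\<close>
    have "inner (v \<circ>\<^sub>J v) c = inner v v"
      using unit[OF vW] by (simp add: inner_jordan_mult jordan_mult_commute)
    then have r0: "r \<noteq> 0" using r v(2) by auto
    define d where "d = (1 / r) *\<^sub>R v"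
    have d: "d \<circ>\<^sub>J d = d" "d \<noteq> 0" "x \<circ>\<^sub>J d = l *\<^sub>R d"
      using r r0 v by (simp_all add: d_def jordan_simps)
    have dC: "d' \<circ>\<^sub>J d = 0" if "d' \<in> C" for d'
    proof -
      have "d' \<circ>\<^sub>J (u \<circ>\<^sub>J e) = u \<circ>\<^sub>J (d' \<circ>\<^sub>J e)" using that CW u by (intro comm) auto
      then have "d' \<circ>\<^sub>J v = 0" using eC[OF that] u(2) by (simp add: jordan_mult_commute)
      then show ?thesis by (simp add: d_def jordan_simps)
    qed
    then have "d \<notin> C" using d by metis
    have "good (insert d C)"
      using C d dC vW sub unfolding good_def orthogonal_idempotents_def
      by (auto simp: d_def subspace_scale jordan_mult_commute)
    from max[OF this] show False
      using \<open>d \<notin> C\<close> oC by (simp add: orthogonal_idempotents_def)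
  qed
  then have sum: "\<Sum>C = c" by (simp add: e_def)
  from C obtain l where l: "\<And>d. d \<in> C \<Longrightarrow> x \<circ>\<^sub>J d = l d *\<^sub>R d" unfolding good_def by metis
  have "x = x \<circ>\<^sub>J \<Sum>C" using sum x by (simp add: jordan_mult_commute)
  also have "\<dots> = (\<Sum>d\<in>C. l d *\<^sub>R d)" by (simp add: jordan_mult.sum_right l)
  finally show thesis using that oC sum by blast
qed

section \<open>Primitive idempotents and Jordan frames\<close>

lemma primitive_idempotentD:
  assumes "primitive_idempotent c" shows "c \<circ>\<^sub>J c = c" "c \<noteq> 0"
  using assms by (auto simp: primitive_idempotent_def jordan_idempotent_def)

lemma idempotent_inner:
  fixes c d :: "'a::euclidean_jordan_algebra"
  assumes "d \<circ>\<^sub>J d = d"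
  shows "inner (c \<circ>\<^sub>J d) d = inner c d"
  using inner_jordan_mult[of d c d] assms by (simp add: jordan_mult_commute)

lemma idempotent_inner_nonneg:
  fixes c d :: "'a::euclidean_jordan_algebra"
  assumes "c \<circ>\<^sub>J c = c" "d \<circ>\<^sub>J d = d"
  shows "0 \<le> inner c d"
  using idempotent_psd[OF assms(1), of d] idempotent_inner[OF assms(2), of c] by simp

text \<open>Multiplication by \<open>c\<close> is positive semidefinite and its form at
  \<open>d\<close> is the inner product of c and d, so \<open>psd_kernel\<close> applies.\<close>

lemma idempotent_inner_zero:
  fixes c d :: "'a::euclidean_jordan_algebra"
  assumes "c \<circ>\<^sub>J c = c" "d \<circ>\<^sub>J d = d" "inner c d = 0"
  shows "c \<circ>\<^sub>J d = 0"
proof (rule psd_kernel[OF linear_jordan_mult _ subspace_UNIV])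
  show "0 \<le> inner u (c \<circ>\<^sub>J u)" for u
    using idempotent_psd[OF assms(1)] by (simp add: inner_commute)
  show "inner d (c \<circ>\<^sub>J d) = 0"
    using idempotent_inner[OF assms(2), of c] assms(3) by (simp add: inner_commute)
qed (auto simp: inner_jordan_mult)

text \<open>The square of p + q exceeds p + q by 2 p \<circ> q. This supplies the orthogonality of
  the two summands in a splitting of a non-primitive idempotent.\<close>

lemma idempotent_sum_orthogonal:
  fixes p q :: "'a::euclidean_jordan_algebra"
  assumes "p \<circ>\<^sub>J p = p" "q \<circ>\<^sub>J q = q" "(p + q) \<circ>\<^sub>J (p + q) = p + q"
  shows "p \<circ>\<^sub>J q = 0"
proof -
  have "2 *\<^sub>R (p \<circ>\<^sub>J q) = 0"
    using assms by (simp add: jordan_simps scaleR_2 jordan_mult_commute)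
  then show ?thesis by simp
qed

lemma idempotent_summand_orthogonal:
  fixes p q d :: "'a::euclidean_jordan_algebra"
  assumes pq: "p \<circ>\<^sub>J p = p" "q \<circ>\<^sub>J q = q" and d: "d \<circ>\<^sub>J d = d" and orth: "inner (p + q) d = 0"
  shows "p \<circ>\<^sub>J d = 0"
  using idempotent_inner_nonneg[OF pq(1) d] idempotent_inner_nonneg[OF pq(2) d] orth
  by (intro idempotent_inner_zero pq d) (simp add: inner_add)

text \<open>Replace \<open>c\<close> by its two summands. Inner products of idempotents are
  nonnegative, so each summand inherits the orthogonality of \<open>c\<close> to the remaining
  members.\<close>

lemma not_primitive_split:
  fixes C :: "'a::euclidean_jordan_algebra set"
  assumes C: "orthogonal_idempotents C" and c: "c \<in> C" "\<not> primitive_idempotent c"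
  obtains C' where "orthogonal_idempotents C'" "\<Sum>C' = \<Sum>C" "card C' = Suc (card C)"
    "\<And>l :: 'a \<Rightarrow> real. \<exists>l'. (\<Sum>d\<in>C'. l' d *\<^sub>R d) = (\<Sum>d\<in>C. l d *\<^sub>R d)"
proof -
  have cc: "c \<circ>\<^sub>J c = c" "c \<noteq> 0" and fin: "finite C"
    using C c by (auto simp: orthogonal_idempotents_def)
  then obtain p q where pq: "p \<circ>\<^sub>J p = p" "p \<noteq> 0" "q \<circ>\<^sub>J q = q" "q \<noteq> 0" "c = p + q"
    using c by (auto simp: primitive_idempotent_def jordan_idempotent_def)
  have orth: "p \<circ>\<^sub>J q = 0" using idempotent_sum_orthogonal pq cc by simp
  have D: "d \<circ>\<^sub>J d = d" "inner c d = 0" if "d \<in> C - {c}" for d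
    using that C c orthogonal_idempotents_inner[of c d] cc by (auto simp: orthogonal_idempotents_def)
  have pd: "p \<circ>\<^sub>J d = 0" if "d \<in> C - {c}" for d
    using idempotent_summand_orthogonal[OF pq(1,3)] D[OF that] pq(5) by simp
  have qd: "q \<circ>\<^sub>J d = 0" if "d \<in> C - {c}" for d
    using idempotent_summand_orthogonal[OF pq(3,1)] D[OF that] pq(5) by (simp add: add.commute)
  have new: "p \<notin> C - {c}" "q \<notin> C - {c}" "p \<noteq> q"
    using pd qd pq orth by auto
  let ?C = "insert p (insert q (C - {c}))"
  show thesis
  proof (rule that)
    show "orthogonal_idempotents ?C"
    proof -
      have "q \<circ>\<^sub>J p = 0" "\<And>d. d \<in> C - {c} \<Longrightarrow> d \<circ>\<^sub>J p = 0" "\<And>d. d \<in> C - {c} \<Longrightarrow> d \<circ>\<^sub>J q = 0"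
        using orth pd qd jordan_mult_commute by metis+
      then show ?thesis
        using C pq(1-4) orth pd qd unfolding orthogonal_idempotents_def by auto
    qed
    show "\<Sum>?C = \<Sum>C"
      using new fin c pq(5) by (simp add: sum.remove[of C c] add_ac)
    show "card ?C = Suc (card C)"
    proof -
      have "card ?C = Suc (Suc (card (C - {c})))" using new fin by (simp del: card_Diff_insert card_Diff_singleton)
      then show ?thesis using card.remove[OF fin c(1)] by simp
    qed
    show "\<exists>l'. (\<Sum>d\<in>?C. l' d *\<^sub>R d) = (\<Sum>d\<in>C. l d *\<^sub>R d)" for l :: "'a \<Rightarrow> real"
    proof (rule exI)
      \<comment> \<open>Both summands receive the coefficient of \<open>c\<close>.\<close>
      let ?l = "\<lambda>d. if d \<in> {p, q} then l c else l d"
      have "(\<Sum>d\<in>C - {c}. ?l d *\<^sub>R d) = (\<Sum>d\<in>C - {c}. l d *\<^sub>R d)"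
        using new by (intro sum.cong) auto
      then show "(\<Sum>d\<in>?C. ?l d *\<^sub>R d) = (\<Sum>d\<in>C. l d *\<^sub>R d)"
        using new fin c pq(5) by (simp add: sum.remove[of C c] add_ac scaleR_add_right)
    qed
  qed
qed

text \<open>Among the orthogonal systems that decompose both the unit and \<open>x\<close>, one of
  greatest cardinality has only primitive members, since any other could be split further. Sorting
  by coefficient orders the eigenvalues.\<close>

lemma spectral_theorem:
  fixes x :: "'a::euclidean_jordan_algebra"
  shows "\<exists>ls es. sorted_wrt (\<ge>) ls \<and> spectral_decomposition x ls es"
proof -
  define good where "good C \<longleftrightarrow> orthogonal_idempotents C \<and> \<Sum>C = jordan_unit \<and>
    (\<exists>l. x = (\<Sum>d\<in>C. l d *\<^sub>R d))" for C :: "'a set"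
  obtain C0 where "good C0"
    using spectral_idempotents[of jordan_unit x] jordan_unit_mult unfolding good_def by metis
  moreover have "card C < Suc DIM('a)" if "good C" for C
    using that card_orthogonal_idempotents[of C] by (simp add: good_def)
  ultimately obtain C where C: "good C" and max: "\<And>C'. good C' \<Longrightarrow> card C' \<le> card C"
    using ex_has_greatest_nat[of good C0 card "Suc DIM('a)"] by blast
  have oC: "orthogonal_idempotents C" using C by (simp add: good_def)
  have prim: "primitive_idempotent c" if c: "c \<in> C" for c
  proof (rule ccontr)
    assume "\<not> primitive_idempotent c"
    from not_primitive_split[OF oC c this] obtain C' where
      C': "orthogonal_idempotents C'" "\<Sum>C' = \<Sum>C" "card C' = Suc (card C)"
      and l': "\<And>l :: 'a \<Rightarrow> real. \<exists>l'. (\<Sum>d\<in>C'. l' d *\<^sub>R d) = (\<Sum>d\<in>C. l d *\<^sub>R d)" by metis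
    obtain l where l: "x = (\<Sum>d\<in>C. l d *\<^sub>R d)" using C by (auto simp: good_def)
    then obtain l' where "x = (\<Sum>d\<in>C'. l' d *\<^sub>R d)" using l'[of l] by metis
    then have "good C'" using C C'(1,2) unfolding good_def by auto
    from max[OF this] C'(3) show False by simp
  qed
  obtain l where l: "x = (\<Sum>d\<in>C. l d *\<^sub>R d)" using C by (auto simp: good_def)
  obtain xs where xs: "set xs = C" "distinct xs"
    using oC finite_distinct_list[of C] by (auto simp: orthogonal_idempotents_def)
  define es where "es = rev (sort_key l xs)"
  have es: "set es = C" "distinct es" using xs by (simp_all add: es_def)
  have "sorted_wrt (\<ge>) (map l es)"
    using sorted_sort_key[of l xs] by (simp add: es_def sorted_wrt_rev flip: rev_map)
  moreover have "jordan_frame es"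
  proof -
    have "sum_list es = jordan_unit"
      using sum_list_distinct_conv_sum_set[of es "\<lambda>d. d"] es C by (simp add: good_def)
    then show ?thesis
      using prim oC es unfolding jordan_frame_def orthogonal_idempotents_def
      by (metis nth_eq_iff_index_eq nth_mem)
  qed
  moreover have "x = (\<Sum>i<length es. map l es ! i *\<^sub>R es ! i)"
    using sum_list_distinct_conv_sum_set[of es "\<lambda>d. l d *\<^sub>R d"] es l
    by (simp add: sum_list_sum_nth atLeast0LessThan)
  ultimately have "spectral_decomposition x (map l es) es" "sorted_wrt (\<ge>) (map l es)"
    by (simp_all add: spectral_decomposition_def)
  then show ?thesis by blast
qed

text \<open>Decompose \<open>x\<close> over \<open>c\<close> as unit. Two distinct members of the
  system would split \<open>c\<close> as d + (c - d), so the system is a single idempotent, namely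
  \<open>c\<close>.\<close>

lemma primitive_peirce_one:
  fixes c x :: "'a::euclidean_jordan_algebra"
  assumes c: "primitive_idempotent c" and x: "c \<circ>\<^sub>J x = x"
  shows "\<exists>r. x = r *\<^sub>R c"
proof -
  note cc = primitive_idempotentD[OF c]
  obtain C l where C: "orthogonal_idempotents C" "\<Sum>C = c" "x = (\<Sum>d\<in>C. l d *\<^sub>R d)"
    using spectral_idempotents[OF cc(1) x] by metis
  then obtain d where d: "d \<in> C" using cc by (metis sum.neutral)
  have "d' = d" if d': "d' \<in> C" for d'
  proof (rule ccontr)
    assume ne: "d' \<noteq> d"
    have 1: "c \<circ>\<^sub>J d = d" "c \<circ>\<^sub>J d' = d'"
      using sum_orthogonal_idempotents[OF C(1)] C(2) d d' by simp_all
    have 2: "d \<circ>\<^sub>J d = d" "d \<noteq> 0" "d' \<noteq> 0" "d \<circ>\<^sub>J d' = 0"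
      using C(1) d d' ne[symmetric] unfolding orthogonal_idempotents_def by blast+
    have "(c - d) \<circ>\<^sub>J (c - d) = c - d"
      using 1 2 cc by (simp add: jordan_simps jordan_mult_commute[of d c])
    moreover have "(c - d) \<circ>\<^sub>J d' \<noteq> 0" using 1 2 by (simp add: jordan_simps)
    then have "c - d \<noteq> 0" by auto
    moreover have "\<not> (jordan_idempotent d \<and> d \<noteq> 0 \<and> jordan_idempotent (c - d) \<and> c - d \<noteq> 0 \<and> c = d + (c - d))"
      using c unfolding primitive_idempotent_def by blast
    ultimately show False
      using 2 by (simp add: jordan_idempotent_def)
  qed
  with d have "C = {d}" by blast
  with C have "c = d" "x = l d *\<^sub>R d" by simp_all
  then show ?thesis by blast
qed

section \<open>Frame coordinates and doubly stochastic matrices\<close>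

text \<open>The coefficient of the orthogonal projection onto the line of \<open>c\<close>; the
  normalisation makes up for an inner product other than the trace form.\<close>

definition frame_coord :: "'a::euclidean_jordan_algebra \<Rightarrow> 'a \<Rightarrow> real" where
  "frame_coord c z = inner c z / inner c c"

text \<open>With \<open>P\<^sub>c\<close> the projection onto \<open>\<real>c\<close>, the inner product
  \<open>\<langle>P\<^sub>c d, d\<rangle> = 2 \<bar>c \<circ> d\<bar>\<^sup>2 - \<langle>c, d\<rangle>\<close> is symmetric in \<open>c\<close> and \<open>d\<close>.\<close>

lemma primitive_norm_eq:
  fixes c d :: "'a::euclidean_jordan_algebra"
  assumes c: "primitive_idempotent c" and d: "primitive_idempotent d" and cd: "inner c d \<noteq> 0"
  shows "inner c c = inner d d"
proof -
  have key: "(2 * inner (c \<circ>\<^sub>J d) (c \<circ>\<^sub>J d) - inner c d) * inner c c = (inner c d)\<^sup>2"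
    if c: "primitive_idempotent c" and d: "primitive_idempotent d" for c d :: 'a
  proof -
    note cc = primitive_idempotentD[OF c] and dd = primitive_idempotentD[OF d]
    \<comment> \<open>By \<open>peirce_cubic\<close>, \<open>?p\<close> lies in the Peirce 1-space
      of \<open>c\<close>, hence is a multiple of \<open>c\<close>. Pairing it with \<open>c\<close>
      and with \<open>d\<close> gives two equations for the factor r.\<close>
    let ?p = "2 *\<^sub>R (c \<circ>\<^sub>J (c \<circ>\<^sub>J d)) - c \<circ>\<^sub>J d"
    have "2 *\<^sub>R (c \<circ>\<^sub>J (c \<circ>\<^sub>J (c \<circ>\<^sub>J d))) - c \<circ>\<^sub>J (c \<circ>\<^sub>J d) = ?p"
      using peirce_cubic[OF cc(1), of d] scaleR_add_left[of 2 1 "c \<circ>\<^sub>J (c \<circ>\<^sub>J d)"] by simp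
    then have "c \<circ>\<^sub>J ?p = ?p"
      by (simp add: jordan_simps)
    then obtain r where r: "?p = r *\<^sub>R c" using primitive_peirce_one[OF c] by blast
    have "inner ?p c = inner c d"
    proof -
      have "inner (c \<circ>\<^sub>J u) c = inner u c" for u by (simp add: inner_jordan_mult cc)
      then show ?thesis by (simp add: inner_diff inner_commute[of d c])
    qed
    then have 1: "r * inner c c = inner c d" by (simp add: r)
    have "inner ?p d = 2 * inner (c \<circ>\<^sub>J d) (c \<circ>\<^sub>J d) - inner c d"
      using idempotent_inner[OF dd(1), of c] by (simp add: inner_diff inner_jordan_mult[of c "c \<circ>\<^sub>J d"])
    then have "r * inner c d = 2 * inner (c \<circ>\<^sub>J d) (c \<circ>\<^sub>J d) - inner c d" by (simp add: r)
    then show ?thesis using 1 by (metis mult.commute mult.left_commute power2_eq_square)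
  qed
  show ?thesis
    using key[OF c d] key[OF d c] cd
    by (metis inner_commute jordan_mult_commute mult_left_cancel mult_zero_left power_not_zero)
qed

lemma frame_coord_sym:
  assumes "primitive_idempotent c" "primitive_idempotent d"
  shows "frame_coord c d = frame_coord d c"
  using primitive_norm_eq[OF assms] by (cases "inner c d = 0") (auto simp: frame_coord_def inner_commute)

lemma frame_coord_nonneg:
  assumes "primitive_idempotent c" "primitive_idempotent d"
  shows "0 \<le> frame_coord c d"
  using assms[THEN primitive_idempotentD(1)] by (simp add: frame_coord_def idempotent_inner_nonneg)

lemma bounded_linear_frame_coord: "bounded_linear (frame_coord c)"
  unfolding frame_coord_def divide_inverse
  by (intro bounded_linear_mult_left[THEN bounded_linear_compose] bounded_linear_inner_right)

lemmas frame_coord_simps = bounded_linear.linear[OF bounded_linear_frame_coord, THEN linear_add]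
  bounded_linear.linear[OF bounded_linear_frame_coord, THEN linear_diff]
  bounded_linear.linear[OF bounded_linear_frame_coord, THEN linear_scale]
  bounded_linear.linear[OF bounded_linear_frame_coord, THEN linear_sum]

lemma frame_coord_unit:
  assumes "primitive_idempotent c" shows "frame_coord c jordan_unit = 1"
  using primitive_idempotentD[OF assms] inner_jordan_mult[of c c jordan_unit]
  by (simp add: frame_coord_def)

lemma jordan_frameD:
  assumes "jordan_frame es"
  shows "i < length es \<Longrightarrow> primitive_idempotent (es ! i)"
    "i < length es \<Longrightarrow> j < length es \<Longrightarrow> i \<noteq> j \<Longrightarrow> es ! i \<circ>\<^sub>J es ! j = 0"
    "(\<Sum>i<length es. es ! i) = jordan_unit"
  using assms by (auto simp: jordan_frame_def sum_list_sum_nth atLeast0LessThan)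

lemma frame_coord_sum_right:
  assumes "jordan_frame es" "primitive_idempotent c"
  shows "(\<Sum>i<length es. frame_coord c (es ! i)) = 1"
  using frame_coord_unit[OF assms(2)] jordan_frameD(3)[OF assms(1)] by (metis frame_coord_simps(4))

text \<open>Row sums are 1 because a frame sums to the unit; symmetry of the coordinates transfers
  this to column sums.\<close>

lemma frame_coord_sum_left:
  assumes "jordan_frame es" "primitive_idempotent c"
  shows "(\<Sum>i<length es. frame_coord (es ! i) c) = 1"
  using frame_coord_sum_right[OF assms] frame_coord_sym[OF assms(2)] jordan_frameD(1)[OF assms(1)]
  by simp

text \<open>Adding all entries of a doubly stochastic matrix counts its rows as well as its
  columns.\<close>

lemma jordan_frame_length_eq:
  fixes es fs :: "'a::euclidean_jordan_algebra list"
  assumes "jordan_frame es" "jordan_frame fs"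
  shows "length es = length fs"
proof -
  have "(\<Sum>i<length es. \<Sum>j<length fs. frame_coord (es ! i) (fs ! j)) =
        (\<Sum>j<length fs. \<Sum>i<length es. frame_coord (es ! i) (fs ! j))"
    by (rule sum.swap)
  then show ?thesis
    using assms by (simp add: frame_coord_sum_left frame_coord_sum_right jordan_frameD(1))
qed

lemma frame_coord_frame:
  assumes "jordan_frame es" "i < length es" "j < length es"
  shows "frame_coord (es ! i) (es ! j) = (if i = j then 1 else 0)"
  using assms jordan_frameD[OF assms(1)] primitive_idempotentD[of "es ! i"]
    orthogonal_idempotents_inner[of "es ! i" "es ! j"]
  by (auto simp: frame_coord_def)

lemma spectral_decompositionD:
  assumes "spectral_decomposition x ls es"
  shows "jordan_frame es" "length ls = length es" "x = (\<Sum>i<length es. ls ! i *\<^sub>R es ! i)"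
  using assms by (auto simp: spectral_decomposition_def)

lemma frame_coord_decomposition:
  assumes "spectral_decomposition x ls es"
  shows "frame_coord c x = (\<Sum>i<length es. ls ! i * frame_coord c (es ! i))"
  unfolding spectral_decompositionD(3)[OF assms] by (simp add: frame_coord_simps)

lemma frame_coord_eigenvalue:
  assumes "spectral_decomposition x ls es" "i < length es"
  shows "frame_coord (es ! i) x = ls ! i"
proof -
  have "frame_coord (es ! i) x = (\<Sum>j<length es. if i = j then ls ! j else 0)"
    unfolding frame_coord_decomposition[OF assms(1)]
    using frame_coord_frame[OF spectral_decompositionD(1)[OF assms(1)] assms(2)]
    by (intro sum.cong) auto
  then show ?thesis using assms(2) by simp
qed

section \<open>Sums of the largest eigenvalues, and uniqueness of the spectrum\<close>

text \<open>Compare \<open>t\<close> with the indicator \<open>s\<close> of the first k indices.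
  Both have total k, so subtracting the constant \<open>ls ! k\<close> changes nothing, and
  afterwards each product (ls_i - ls_k)(t_i - s_i) is at most 0.\<close>

lemma weighted_sum_le_initial_sum:
  fixes ls :: "real list"
  assumes sorted: "sorted_wrt (\<ge>) ls" and k: "k \<le> length ls"
    and t: "\<And>i. i < length ls \<Longrightarrow> 0 \<le> t i \<and> t i \<le> 1" and sum: "(\<Sum>i<length ls. t i) = real k"
  shows "(\<Sum>i<length ls. ls ! i * t i) \<le> (\<Sum>i<k. ls ! i)"
proof (cases "k = length ls")
  \<comment> \<open>Here \<open>ls ! k\<close> is out of range; instead every weight is forced to be
    1.\<close>
  case True
  have "(\<Sum>i<length ls. 1 - t i) = 0" using sum True by (simp add: sum_subtractf)
  then have "t i = 1" if "i < length ls" for i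
    using that t sum_nonneg_eq_0_iff[of "{..<length ls}" "\<lambda>i. 1 - t i"] by simp
  then show ?thesis using True by simp
next
  case False
  define s where "s i = (if i < k then 1 else 0 :: real)" for i
  have le: "{..<length ls} \<inter> {i. i < k} = {..<k}" using k by auto
  have s1: "(\<Sum>i<length ls. s i) = real k" using k by (simp add: s_def sum.If_cases le)
  have s2: "(\<Sum>i<length ls. ls ! i * s i) = (\<Sum>i<k. ls ! i)"
    using k by (simp add: s_def if_distrib[of "(*) _"] sum.If_cases le cong: if_cong)
  have mono: "ls ! j \<le> ls ! i" if "i \<le> j" "j < length ls" for i j
    using sorted that by (metis le_neq_implies_less order_refl sorted_wrt_iff_nth_less)
  have "(\<Sum>i<length ls. (ls ! i - ls ! k) * (t i - s i)) \<le> 0"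
  proof (rule sum_nonpos)
    fix i assume "i \<in> {..<length ls}"
    then show "(ls ! i - ls ! k) * (t i - s i) \<le> 0"
      using t[of i] mono[of i k] mono[of k i] False k
      by (cases "i < k") (auto simp: s_def mult_nonneg_nonpos mult_nonpos_nonneg)
  qed
  moreover have "(\<Sum>i<length ls. (ls ! i - ls ! k) * (t i - s i)) =
    (\<Sum>i<length ls. ls ! i * t i) - (\<Sum>i<length ls. ls ! i * s i)
     - ls ! k * ((\<Sum>i<length ls. t i) - (\<Sum>i<length ls. s i))"
    by (simp add: algebra_simps sum_subtractf sum.distrib sum_distrib_left)
  ultimately show ?thesis by (simp add: s1 s2 sum)
qed

text \<open>The coordinates of \<open>z\<close> in \<open>fs\<close> arise from its eigenvalues by a
  doubly stochastic matrix; \<open>t i\<close> adds the first k entries of column i.\<close>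

lemma frame_coord_sum_le:
  assumes z: "spectral_decomposition z ls es" "sorted_wrt (\<ge>) ls"
    and fs: "jordan_frame fs" and k: "k \<le> length fs"
  shows "(\<Sum>l<k. frame_coord (fs ! l) z) \<le> (\<Sum>l<k. ls ! l)"
proof -
  note es = spectral_decompositionD(1,2)[OF z(1)]
  have len: "length fs = length ls" using jordan_frame_length_eq[OF fs es(1)] es(2) by simp
  define t where "t i = (\<Sum>l<k. frame_coord (fs ! l) (es ! i))" for i
  have "(\<Sum>l<k. frame_coord (fs ! l) z) = (\<Sum>i<length ls. ls ! i * t i)"
    unfolding frame_coord_decomposition[OF z(1)] t_def sum_distrib_left es(2) by (rule sum.swap)
  also have "\<dots> \<le> (\<Sum>l<k. ls ! l)"
  proof (rule weighted_sum_le_initial_sum[OF z(2)])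
    show "k \<le> length ls" using k len by simp
    show "0 \<le> t i \<and> t i \<le> 1" if i: "i < length ls" for i
    proof
      have prim: "primitive_idempotent (es ! i)" using i es jordan_frameD(1) by metis
      have nn: "0 \<le> frame_coord (fs ! l) (es ! i)" if "l < length fs" for l
        using frame_coord_nonneg[OF jordan_frameD(1)[OF fs that] prim] .
      then show "0 \<le> t i" unfolding t_def using k by (intro sum_nonneg) auto
      have "t i \<le> (\<Sum>l<length fs. frame_coord (fs ! l) (es ! i))"
        unfolding t_def using k nn by (intro sum_mono2) auto
      then show "t i \<le> 1" using frame_coord_sum_left[OF fs prim] by simp
    qed
    have "(\<Sum>i<length ls. t i) = (\<Sum>l<k. \<Sum>i<length ls. frame_coord (fs ! l) (es ! i))"
      unfolding t_def by (rule sum.swap)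
    also have "\<dots> = real k"
      using frame_coord_sum_right[OF es(1)] es(2) jordan_frameD(1)[OF fs] k by simp
    finally show "(\<Sum>i<length ls. t i) = real k" .
  qed
  finally show ?thesis .
qed

text \<open>Each initial sum is the maximum over all frames of the corresponding coordinate sums, so
  initial sums agree, and so do their successive differences.\<close>

lemma eigenvalues_unique:
  assumes "spectral_decomposition z ls es" "sorted_wrt (\<ge>) ls"
    and "spectral_decomposition z ms fs" "sorted_wrt (\<ge>) ms"
  shows "ls = ms"
proof -
  note es = spectral_decompositionD(1,2)[OF assms(1)] and fs = spectral_decompositionD(1,2)[OF assms(3)]
  have len: "length es = length fs" using jordan_frame_length_eq es fs by blast
  have S: "(\<Sum>l<k. ls ! l) = (\<Sum>l<k. ms ! l)" if "k \<le> length es" for k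
  proof (rule antisym)
    show "(\<Sum>l<k. ls ! l) \<le> (\<Sum>l<k. ms ! l)"
      using frame_coord_sum_le[OF assms(3,4) es(1) that] frame_coord_eigenvalue[OF assms(1)] that by simp
    show "(\<Sum>l<k. ms ! l) \<le> (\<Sum>l<k. ls ! l)"
      using frame_coord_sum_le[OF assms(1,2) fs(1)] frame_coord_eigenvalue[OF assms(3)] that len by simp
  qed
  show ?thesis
  proof (rule nth_equalityI)
    show "ls ! i = ms ! i" if "i < length ls" for i
      using S[of i] S[of "Suc i"] that es by simp
  qed (simp add: es fs len)
qed

lemma eigenvalues:
  fixes x :: "'a::euclidean_jordan_algebra"
  obtains es where "spectral_decomposition x (eigenvalues x) es" "sorted_wrt (\<ge>) (eigenvalues x)"
proof -
  have "\<exists>!ls. sorted_wrt (\<ge>) ls \<and> (\<exists>es. spectral_decomposition x ls es)"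
    using spectral_theorem[of x] eigenvalues_unique by blast
  from theI'[OF this] show thesis using that unfolding eigenvalues_def by blast
qed

lemma jordan_frame_length:
  assumes "jordan_frame (es :: 'a::euclidean_jordan_algebra list)"
  shows "length es = jordan_rank TYPE('a)"
  unfolding jordan_rank_def using assms jordan_frame_length_eq
  by (intro the_equality[symmetric]) blast+

lemma length_eigenvalues: "length (eigenvalues (x :: 'a::euclidean_jordan_algebra)) = jordan_rank TYPE('a)"
  by (metis eigenvalues jordan_frame_length spectral_decompositionD(1,2))

section \<open>The trace\<close>

text \<open>The vector that represents the trace with respect to the given inner product.\<close>

definition frame_trace :: "'a::euclidean_jordan_algebra list \<Rightarrow> 'a" where
  "frame_trace es = (\<Sum>i<length es. (1 / inner (es ! i) (es ! i)) *\<^sub>R es ! i)"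

lemma inner_frame_trace: "inner (frame_trace es) z = (\<Sum>i<length es. frame_coord (es ! i) z)"
  by (simp add: frame_trace_def inner_sum_left frame_coord_def)

lemma frame_coord_sum_eq:
  assumes z: "spectral_decomposition z ls es" and fs: "jordan_frame fs"
  shows "(\<Sum>i<length fs. frame_coord (fs ! i) z) = (\<Sum>i<length es. ls ! i)"
proof -
  note es = spectral_decompositionD(1)[OF z]
  have "(\<Sum>i<length fs. frame_coord (fs ! i) z)
      = (\<Sum>j<length es. \<Sum>i<length fs. ls ! j * frame_coord (fs ! i) (es ! j))"
    unfolding frame_coord_decomposition[OF z] by (rule sum.swap)
  also have "\<dots> = (\<Sum>j<length es. ls ! j)"
    using frame_coord_sum_left[OF fs] jordan_frameD(1)[OF es] by (simp flip: sum_distrib_left)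
  finally show ?thesis .
qed

lemma frame_trace_eq:
  assumes "jordan_frame es" "jordan_frame fs"
  shows "frame_trace es = frame_trace fs"
proof -
  have "inner (frame_trace es) z = inner (frame_trace fs) z" for z
  proof -
    obtain ls hs where z: "spectral_decomposition z ls hs" using spectral_theorem by blast
    show ?thesis
      unfolding inner_frame_trace frame_coord_sum_eq[OF z assms(1)] frame_coord_sum_eq[OF z assms(2)] ..
  qed
  then show ?thesis by (subst vector_eq_rdot[symmetric]) simp
qed

lemma frame_combination_commute:
  assumes "jordan_frame es"
  shows "(\<Sum>i<length es. p i *\<^sub>R es ! i) \<circ>\<^sub>J ((\<Sum>j<length es. q j *\<^sub>R es ! j) \<circ>\<^sub>J y) =
    (\<Sum>j<length es. q j *\<^sub>R es ! j) \<circ>\<^sub>J ((\<Sum>i<length es. p i *\<^sub>R es ! i) \<circ>\<^sub>J y)"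
proof -
  have expand: "(\<Sum>i<length es. p i *\<^sub>R es ! i) \<circ>\<^sub>J ((\<Sum>j<length es. q j *\<^sub>R es ! j) \<circ>\<^sub>J y) =
    (\<Sum>i<length es. \<Sum>j<length es. (p i * q j) *\<^sub>R (es ! i \<circ>\<^sub>J (es ! j \<circ>\<^sub>J y)))" for p q
    by (simp only: jordan_mult.sum_left, simp only: jordan_mult.sum_right) (simp add: jordan_simps mult.commute)
  have comm: "es ! i \<circ>\<^sub>J (es ! j \<circ>\<^sub>J y) = es ! j \<circ>\<^sub>J (es ! i \<circ>\<^sub>J y)" if "i < length es" "j < length es" for i j
  proof (cases "i = j")
    case False
    then show ?thesis
      using that by (intro orthogonal_idempotent_commute jordan_frameD(2)[OF assms]
          primitive_idempotentD(1) jordan_frameD(1)[OF assms])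
  qed simp
  have "(\<Sum>i<length es. \<Sum>j<length es. (p i * q j) *\<^sub>R (es ! i \<circ>\<^sub>J (es ! j \<circ>\<^sub>J y))) =
     (\<Sum>j<length es. \<Sum>i<length es. (p i * q j) *\<^sub>R (es ! i \<circ>\<^sub>J (es ! j \<circ>\<^sub>J y)))"
    by (rule sum.swap)
  also have "\<dots> = (\<Sum>j<length es. \<Sum>i<length es. (q j * p i) *\<^sub>R (es ! j \<circ>\<^sub>J (es ! i \<circ>\<^sub>J y)))"
    by (intro sum.cong refl) (simp add: comm mult.commute)
  finally show ?thesis unfolding expand .
qed

text \<open>The vector does not depend on the frame, so it may be computed in a frame of
  \<open>x\<close>, where both are combinations of the same idempotents.\<close>

lemma frame_trace_central:
  assumes "jordan_frame es"
  shows "frame_trace es \<circ>\<^sub>J (x \<circ>\<^sub>J y) = x \<circ>\<^sub>J (frame_trace es \<circ>\<^sub>J y)"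
proof -
  obtain ls hs where x: "spectral_decomposition x ls hs" using spectral_theorem by blast
  note hs = spectral_decompositionD[OF x]
  show ?thesis
    unfolding frame_trace_eq[OF assms hs(1)] unfolding frame_trace_def
    by (subst (1 2) hs(3)) (rule frame_combination_commute[OF hs(1)])
qed

lemma jordan_frame_combination_mult:
  assumes "jordan_frame es" "i < length es"
  shows "(\<Sum>j<length es. p j *\<^sub>R es ! j) \<circ>\<^sub>J es ! i = p i *\<^sub>R es ! i"
proof -
  have "(\<Sum>j<length es. p j *\<^sub>R es ! j) \<circ>\<^sub>J es ! i = (\<Sum>j<length es. if j = i then p i *\<^sub>R es ! i else 0)"
    unfolding jordan_mult.sum_left using jordan_frameD[OF assms(1)] assms(2) primitive_idempotentD(1)
    by (intro sum.cong) (auto simp: jordan_simps)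
  then show ?thesis using assms(2) by simp
qed

text \<open>The left side is the trace form, the trace of z \<circ> y, here expanded in a frame of
  \<open>z\<close>.\<close>

lemma inner_frame_trace_mult:
  assumes z: "spectral_decomposition z ls es"
  shows "inner (frame_trace es \<circ>\<^sub>J z) y = (\<Sum>i<length es. ls ! i * frame_coord (es ! i) y)"
proof -
  note es = spectral_decompositionD[OF z]
  have "frame_trace es \<circ>\<^sub>J z = (\<Sum>i<length es. ls ! i *\<^sub>R (frame_trace es \<circ>\<^sub>J es ! i))"
    by (subst es(3)) (simp add: jordan_mult.sum_right jordan_simps)
  also have "\<dots> = (\<Sum>i<length es. ls ! i *\<^sub>R (1 / inner (es ! i) (es ! i)) *\<^sub>R es ! i)"
    unfolding frame_trace_def using jordan_frame_combination_mult[OF es(1)] by (intro sum.cong) auto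
  finally show ?thesis by (simp add: inner_sum_left frame_coord_def)
qed

lemma frame_trace_quadratic:
  assumes z: "spectral_decomposition z ls es"
  shows "inner (frame_trace es \<circ>\<^sub>J z) z = (\<Sum>i<length es. (ls ! i)\<^sup>2)"
  unfolding inner_frame_trace_mult[OF z] using frame_coord_eigenvalue[OF z]
  by (simp add: power2_eq_square)

section \<open>The commutator field\<close>

text \<open>For fixed \<open>x\<close> this is the derivation [L_x, L_a]; on the diagonal y = x it
  is the vector field of the flow.\<close>

definition commutator_field :: "'a::euclidean_jordan_algebra \<Rightarrow> 'a \<Rightarrow> 'a \<Rightarrow> 'a" where
  "commutator_field a x y = x \<circ>\<^sub>J (a \<circ>\<^sub>J y) - a \<circ>\<^sub>J (x \<circ>\<^sub>J y)"

text \<open>For \<open>i \<noteq> j\<close> this is a quarter of the squared trace norm of the \<open>(i, j)\<close> Peirce component of \<open>x\<close>.\<close>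

definition peirce_weight :: "'a::euclidean_jordan_algebra list \<Rightarrow> 'a \<Rightarrow> nat \<Rightarrow> nat \<Rightarrow> real" where
  "peirce_weight es x i j = inner (es ! i \<circ>\<^sub>J x) (es ! j \<circ>\<^sub>J x) / inner (es ! i) (es ! i)"

context
  fixes es :: "'a::euclidean_jordan_algebra list" and w x a :: 'a and ls :: "real list"
  assumes w: "spectral_decomposition w ls es" and a: "a = x - w"
begin

text \<open>The normalising factor can be absorbed into multiplication by the central vector
  \<open>frame_trace es\<close>, which is self-adjoint and commutes past \<open>x\<close>.\<close>

lemma peirce_weight_sym:
  assumes "i < length es" "j < length es"
  shows "peirce_weight es x i j = peirce_weight es x j i"
proof -
  note es = spectral_decompositionD(1)[OF w]
  let ?g = "frame_trace es"
  have 1: "peirce_weight es x i j = inner (?g \<circ>\<^sub>J (es ! i \<circ>\<^sub>J x)) (es ! j \<circ>\<^sub>J x)" if "i < length es" for i j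
  proof -
    have "?g \<circ>\<^sub>J (es ! i \<circ>\<^sub>J x) = x \<circ>\<^sub>J (?g \<circ>\<^sub>J es ! i)"
      using frame_trace_central[OF es, of x "es ! i"] by (simp add: jordan_mult_commute)
    also have "?g \<circ>\<^sub>J es ! i = (1 / inner (es ! i) (es ! i)) *\<^sub>R es ! i"
      unfolding frame_trace_def by (rule jordan_frame_combination_mult[OF es that])
    finally show ?thesis
      by (simp add: peirce_weight_def jordan_simps jordan_mult_commute)
  qed
  show ?thesis
    unfolding 1[OF assms(1)] 1[OF assms(2)] by (metis inner_commute inner_jordan_mult)
qed

lemma peirce_weight_nonneg:
  assumes "i < length es" "j < length es" "i \<noteq> j"
  shows "0 \<le> peirce_weight es x i j"
  unfolding peirce_weight_def
  using assms jordan_frameD[OF spectral_decompositionD(1)[OF w]] primitive_idempotentD(1)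
  by (intro divide_nonneg_nonneg orthogonal_idempotents_psd) auto

text \<open>As a = x - w, the field is w \<circ> (x \<circ> x) - x \<circ> (w \<circ> x). The first
  term contributes the eigenvalue of e_i, with the unit expanded in the frame; the second
  contributes those of e_j through the expansion of \<open>w\<close>.\<close>

lemma frame_coord_commutator_field:
  assumes i: "i < length es"
  shows "frame_coord (es ! i) (commutator_field a x x) =
    (\<Sum>j<length es. (ls ! i - ls ! j) * peirce_weight es x i j)"
proof -
  note es = spectral_decompositionD[OF w]
  let ?c = "es ! i"
  have E: "commutator_field a x x = w \<circ>\<^sub>J (x \<circ>\<^sub>J x) - x \<circ>\<^sub>J (w \<circ>\<^sub>J x)"
    by (simp add: commutator_field_def a jordan_simps)
  have wc: "w \<circ>\<^sub>J ?c = ls ! i *\<^sub>R ?c"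
    by (subst es(3)) (rule jordan_frame_combination_mult[OF es(1) i])
  have "inner ?c (w \<circ>\<^sub>J (x \<circ>\<^sub>J x)) = ls ! i * inner ?c (x \<circ>\<^sub>J x)"
    by (metis inner_jordan_mult inner_scaleR_left wc)
  also have "inner ?c (x \<circ>\<^sub>J x) = inner (?c \<circ>\<^sub>J x) (jordan_unit \<circ>\<^sub>J x)"
    by (metis inner_jordan_mult jordan_mult_commute jordan_unit_mult)
  also have "\<dots> = (\<Sum>j<length es. inner (?c \<circ>\<^sub>J x) (es ! j \<circ>\<^sub>J x))"
    unfolding jordan_frameD(3)[OF es(1), symmetric] by (simp add: jordan_mult.sum_left inner_sum_right)
  finally have 1: "inner ?c (w \<circ>\<^sub>J (x \<circ>\<^sub>J x)) = (\<Sum>j<length es. ls ! i * inner (?c \<circ>\<^sub>J x) (es ! j \<circ>\<^sub>J x))"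
    by (simp add: sum_distrib_left)
  have "inner ?c (x \<circ>\<^sub>J (w \<circ>\<^sub>J x)) = inner (?c \<circ>\<^sub>J x) (w \<circ>\<^sub>J x)"
    by (metis inner_jordan_mult jordan_mult_commute)
  also have "\<dots> = (\<Sum>j<length es. ls ! j * inner (?c \<circ>\<^sub>J x) (es ! j \<circ>\<^sub>J x))"
    by (subst es(3)) (simp add: jordan_mult.sum_left inner_sum_right jordan_simps)
  finally show ?thesis
    unfolding frame_coord_def E peirce_weight_def inner_diff_right 1
    by (simp add: left_diff_distrib sum_subtractf sum_divide_distrib diff_divide_distrib)
qed

text \<open>The summands \<open>t i j\<close> are antisymmetric, so the block of indices below k
  cancels. What remains has i < k \<le> j, where the eigenvalue difference is nonnegative; for k
  equal to the rank nothing remains.\<close>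

lemma initial_sum_commutator_field:
  assumes k: "k \<le> length es" and sorted: "sorted_wrt (\<ge>) ls"
  shows "0 \<le> (\<Sum>i<k. frame_coord (es ! i) (commutator_field a x x))"
    and "k = length es \<Longrightarrow> (\<Sum>i<k. frame_coord (es ! i) (commutator_field a x x)) = 0"
proof -
  note len = spectral_decompositionD(2)[OF w]
  define t where "t i j = (ls ! i - ls ! j) * peirce_weight es x i j" for i j
  have anti: "t i j = - t j i" if "i < length es" "j < length es" for i j
    using peirce_weight_sym[OF that] by (simp add: t_def algebra_simps)
  have "(\<Sum>i<k. \<Sum>j<k. t i j) = (\<Sum>i<k. \<Sum>j<k. - t j i)"
    using k by (intro sum.cong refl anti) auto
  also have "\<dots> = - (\<Sum>i<k. \<Sum>j<k. t i j)"
    by (simp add: sum_negf) (rule sum.swap)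
  finally have zero: "(\<Sum>i<k. \<Sum>j<k. t i j) = 0" by simp
  have "(\<Sum>i<k. frame_coord (es ! i) (commutator_field a x x)) = (\<Sum>i<k. \<Sum>j<length es. t i j)"
    using frame_coord_commutator_field k by (simp add: t_def)
  also have "\<dots> = (\<Sum>i<k. (\<Sum>j<k. t i j) + (\<Sum>j\<in>{k..<length es}. t i j))"
    using k by (simp add: atLeast0LessThan[symmetric] sum.atLeastLessThan_concat)
  finally have eq: "(\<Sum>i<k. frame_coord (es ! i) (commutator_field a x x)) =
      (\<Sum>i<k. \<Sum>j\<in>{k..<length es}. t i j)"
    by (simp add: sum.distrib zero)
  show "0 \<le> (\<Sum>i<k. frame_coord (es ! i) (commutator_field a x x))"
    unfolding eq
  proof (intro sum_nonneg)
    fix i j assume "i \<in> {..<k}" "j \<in> {k..<length es}"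
    then have "i < j" "j < length es" by auto
    then show "0 \<le> t i j"
      using peirce_weight_nonneg[of i j] sorted len by (simp add: t_def sorted_wrt_iff_nth_less)
  qed
  show "(\<Sum>i<k. frame_coord (es ! i) (commutator_field a x x)) = 0" if "k = length es"
    using eq that by simp
qed

text \<open>This is half the rate of change of the trace of w \<circ> w along the field.
  Symmetrising the double sum in i and j produces the squares.\<close>

lemma frame_trace_commutator_field:
  "inner (frame_trace es \<circ>\<^sub>J w) (commutator_field a x x) =
     (\<Sum>i<length es. \<Sum>j<length es. (ls ! i - ls ! j)\<^sup>2 * peirce_weight es x i j) / 2"
proof -
  let ?r = "peirce_weight es x" and ?n = "length es"
  let ?X = "\<Sum>i<?n. \<Sum>j<?n. ls ! i * (ls ! i - ls ! j) * ?r i j"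
  have "inner (frame_trace es \<circ>\<^sub>J w) (commutator_field a x x) = ?X"
    unfolding inner_frame_trace_mult[OF w] using frame_coord_commutator_field
    by (simp add: sum_distrib_left mult.assoc)
  moreover have "?X = (\<Sum>i<?n. \<Sum>j<?n. ls ! j * (ls ! j - ls ! i) * ?r i j)"
    by (subst sum.swap, intro sum.cong) (auto simp: peirce_weight_sym)
  then have "2 * ?X = (\<Sum>i<?n. \<Sum>j<?n. ls ! i * (ls ! i - ls ! j) * ?r i j + ls ! j * (ls ! j - ls ! i) * ?r i j)"
    unfolding sum.distrib mult_2 by (rule arg_cong)
  then have "2 * ?X = (\<Sum>i<?n. \<Sum>j<?n. (ls ! i - ls ! j)\<^sup>2 * ?r i j)"
    by (simp only:) (intro sum.cong refl, simp add: power2_eq_square algebra_simps)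
  ultimately show ?thesis by simp
qed

lemma commutator_rate_nonneg: "0 \<le> inner (frame_trace es \<circ>\<^sub>J w) (commutator_field a x x)"
  unfolding frame_trace_commutator_field
proof (intro divide_nonneg_nonneg sum_nonneg)
  fix i j assume "i \<in> {..<length es}" "j \<in> {..<length es}"
  then show "0 \<le> (ls ! i - ls ! j)\<^sup>2 * peirce_weight es x i j"
    by (cases "i = j") (auto simp: peirce_weight_nonneg)
qed simp

text \<open>A zero rate kills the Peirce components of \<open>x\<close> between different
  eigenvalues of \<open>w\<close>. Then \<open>x\<close> commutes with each spectral projection of
  \<open>w\<close>, hence with \<open>w\<close> and with a = x - w.\<close>

lemma commutator_rate_zero:
  assumes zero: "inner (frame_trace es \<circ>\<^sub>J w) (commutator_field a x x) = 0"
  shows "operator_commute a x"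
proof -
  note es = spectral_decompositionD[OF w]
  let ?n = "length es"
  have nn: "0 \<le> (ls ! i - ls ! j)\<^sup>2 * peirce_weight es x i j" if "i < ?n" "j < ?n" for i j
    using that by (cases "i = j") (auto simp: peirce_weight_nonneg)
  have "(\<Sum>i<?n. \<Sum>j<?n. (ls ! i - ls ! j)\<^sup>2 * peirce_weight es x i j) = 0"
    using zero by (simp add: frame_trace_commutator_field)
  then have "\<forall>i\<in>{..<?n}. (\<Sum>j<?n. (ls ! i - ls ! j)\<^sup>2 * peirce_weight es x i j) = 0"
    using nn by (subst (asm) sum_nonneg_eq_0_iff) (auto intro!: sum_nonneg)
  then have "(ls ! i - ls ! j)\<^sup>2 * peirce_weight es x i j = 0" if "i < ?n" "j < ?n" for i j
    using that nn sum_nonneg_eq_0_iff[of "{..<?n}" "\<lambda>j. (ls ! i - ls ! j)\<^sup>2 * peirce_weight es x i j"]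
    by simp
  then have inner0: "inner (es ! i \<circ>\<^sub>J x) (es ! j \<circ>\<^sub>J x) = 0"
    if "i < ?n" "j < ?n" "ls ! i \<noteq> ls ! j" for i j
    using that jordan_frameD(1)[OF es(1)] primitive_idempotentD(2)
    by (fastforce simp: peirce_weight_def)
  \<comment> \<open>The product of the two commuting multiplications is positive semidefinite with
    vanishing form at \<open>x\<close>, so \<open>psd_kernel\<close> turns a zero inner product into
    a zero vector.\<close>
  have zero: "es ! i \<circ>\<^sub>J (es ! j \<circ>\<^sub>J x) = 0" if ij: "i < ?n" "j < ?n" "ls ! i \<noteq> ls ! j" for i j
  proof -
    let ?f = "(\<circ>\<^sub>J) (es ! i) \<circ> (\<circ>\<^sub>J) (es ! j)"
    have pr: "es ! i \<circ>\<^sub>J es ! i = es ! i" "es ! j \<circ>\<^sub>J es ! j = es ! j" "es ! i \<circ>\<^sub>J es ! j = 0"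
      using ij jordan_frameD[OF es(1)] primitive_idempotentD(1) by auto
    have eq: "inner u (?f v) = inner (es ! i \<circ>\<^sub>J u) (es ! j \<circ>\<^sub>J v)" for u v
      by (simp add: inner_jordan_mult)
    have "?f x = 0"
    proof (rule psd_kernel[where f = ?f and u = x, OF _ _ subspace_UNIV])
      show "linear ?f" by (intro linear_compose linear_jordan_mult)
      show "inner (?f u) v = inner u (?f v)" for u v
        using orthogonal_idempotent_commute[OF pr(1,3), of v] by (simp add: inner_jordan_mult)
      show "0 \<le> inner u (?f u)" for u unfolding eq by (rule orthogonal_idempotents_psd[OF pr])
      show "inner x (?f x) = 0" unfolding eq by (rule inner0[OF ij])
    qed auto
    then show ?thesis by simp
  qed
  \<comment> \<open>Equal eigenvalues are grouped: \<open>c s\<close> is the spectral projection of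
    \<open>w\<close> for the value s.\<close>
  define I where "I s = {i\<in>{..<?n}. ls ! i = s}" for s
  define c where "c s = (\<Sum>i\<in>I s. es ! i)" for s
  have cx: "c s \<circ>\<^sub>J (x \<circ>\<^sub>J y) = x \<circ>\<^sub>J (c s \<circ>\<^sub>J y)" for s y
  proof (rule peirce_diagonal_commute)
    have "c s \<circ>\<^sub>J es ! i = es ! i" if "i \<in> I s" for i
    proof -
      have "c s \<circ>\<^sub>J es ! i = (\<Sum>j\<in>I s. if j = i then es ! i else 0)"
        unfolding c_def jordan_mult.sum_left
        using jordan_frameD[OF es(1)] primitive_idempotentD(1) that
        by (intro sum.cong) (auto simp: I_def)
      then show ?thesis using that by (simp add: I_def)
    qed
    then show "c s \<circ>\<^sub>J c s = c s" by (subst (2) c_def, simp add: jordan_mult.sum_right) (simp add: c_def)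
    \<comment> \<open>Now \<open>x\<close> has no Peirce 1/2-component for \<open>c s\<close>: only
      products with i in \<open>I s\<close> and j outside occur.\<close>
    have "jordan_unit - c s = (\<Sum>j\<in>{..<?n} - I s. es ! j)"
      unfolding jordan_frameD(3)[OF es(1), symmetric] c_def
      by (subst sum_diff) (auto simp: I_def)
    then have "c s \<circ>\<^sub>J ((jordan_unit - c s) \<circ>\<^sub>J x) = (\<Sum>j\<in>{..<?n} - I s. \<Sum>i\<in>I s. es ! i \<circ>\<^sub>J (es ! j \<circ>\<^sub>J x))"
      by (simp add: c_def jordan_mult.sum_left jordan_mult.sum_right)
    also have "\<dots> = 0"
      using zero by (intro sum.neutral ballI) (auto simp: I_def)
    finally show "c s \<circ>\<^sub>J (c s \<circ>\<^sub>J x) = c s \<circ>\<^sub>J x" by (simp add: jordan_simps jordan_unit_mult)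
  qed
  have "w = (\<Sum>s\<in>set ls. \<Sum>i\<in>I s. ls ! i *\<^sub>R es ! i)"
    unfolding I_def using es(2) by (subst sum.group) (auto simp: es(3))
  also have "\<dots> = (\<Sum>s\<in>set ls. s *\<^sub>R c s)"
    unfolding c_def scaleR_sum_right by (intro sum.cong) (auto simp: I_def)
  finally have "w \<circ>\<^sub>J (x \<circ>\<^sub>J y) = x \<circ>\<^sub>J (w \<circ>\<^sub>J y)" for y
    by (simp add: jordan_mult.sum_left jordan_mult.sum_right jordan_simps cx)
  then show ?thesis
    by (simp add: operator_commute_iff a jordan_simps)
qed

end

section \<open>Partial sums of eigenvalues\<close>

definition eigenvalue_sum :: "nat \<Rightarrow> 'a::euclidean_jordan_algebra \<Rightarrow> real" where
  "eigenvalue_sum k z = (\<Sum>i<k. eigenvalues z ! i)"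

lemma eigenvalue_sum_ge:
  assumes "jordan_frame fs" "k \<le> length fs"
  shows "(\<Sum>l<k. frame_coord (fs ! l) z) \<le> eigenvalue_sum k z"
  unfolding eigenvalue_sum_def by (metis assms eigenvalues frame_coord_sum_le)

text \<open>A nonzero idempotent has norm at least 1/K, because its norm is that of its square and
  so at most K times the norm squared.\<close>

lemma primitive_frame_coord_bounded:
  obtains K where "0 < K" "\<And>c y :: 'a::euclidean_jordan_algebra. primitive_idempotent c \<Longrightarrow> \<bar>frame_coord c y\<bar> \<le> K * norm y"
proof -
  obtain K where K: "0 < K" "\<And>u v :: 'a. norm (u \<circ>\<^sub>J v) \<le> norm u * norm v * K"
    using jordan_mult.pos_bounded by blast
  have "\<bar>frame_coord c y\<bar> \<le> K * norm y" if c: "primitive_idempotent c" for c y :: 'a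
  proof -
    note cc = primitive_idempotentD[OF c]
    have n: "0 < norm c" using cc by simp
    have "norm c * 1 \<le> norm c * (norm c * K)" using K(2)[of c c] cc by (simp add: mult_ac)
    then have "1 \<le> norm c * K" using n by (simp only: mult_le_cancel_left_pos)
    then have "norm c * norm y \<le> norm c * norm y * (norm c * K)"
      by (metis mult.right_neutral mult_left_mono norm_ge_zero zero_le_mult_iff)
    moreover have "\<bar>inner c y\<bar> \<le> norm c * norm y" by (rule Cauchy_Schwarz_ineq2)
    ultimately have "\<bar>inner c y\<bar> \<le> K * norm y * (norm c * norm c)" by (simp add: mult_ac)
    then show ?thesis
      using n by (simp add: frame_coord_def divide_le_eq dot_square_norm power2_eq_square)
  qed
  with K(1) show thesis using that by blast
qed

lemma initial_frame_coord_bounded: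
  obtains L where "0 < L" "\<And>k (es :: 'a::euclidean_jordan_algebra list) y. jordan_frame es \<Longrightarrow> k \<le> length es \<Longrightarrow>
     \<bar>\<Sum>l<k. frame_coord (es ! l) y\<bar> \<le> L * norm y"
proof -
  obtain K where K: "0 < K" "\<And>c y :: 'a. primitive_idempotent c \<Longrightarrow> \<bar>frame_coord c y\<bar> \<le> K * norm y"
    using primitive_frame_coord_bounded by blast
  define n where "n = real (jordan_rank TYPE('a)) + 1"
  have "\<bar>\<Sum>l<k. frame_coord (es ! l) y\<bar> \<le> (n * K) * norm y"
    if es: "jordan_frame es" "k \<le> length es" for k and es :: "'a list" and y
  proof -
    have "\<bar>\<Sum>l<k. frame_coord (es ! l) y\<bar> \<le> (\<Sum>l<k. \<bar>frame_coord (es ! l) y\<bar>)" by (rule sum_abs)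
    also have "\<dots> \<le> (\<Sum>l<k. K * norm y)"
      using es(2) jordan_frameD(1)[OF es(1)] K(2) by (intro sum_mono) auto
    also have "\<dots> = real k * (K * norm y)" by simp
    also have "\<dots> \<le> n * (K * norm y)"
      using es jordan_frame_length[OF es(1)] K(1) by (intro mult_right_mono) (auto simp: n_def)
    finally show ?thesis by (simp add: mult_ac)
  qed
  moreover have "0 < n * K" using K by (simp add: n_def)
  ultimately show thesis using that by blast
qed

lemma eigenvalue_sum_frame:
  assumes "spectral_decomposition z (eigenvalues z) es" "k \<le> length es"
  shows "eigenvalue_sum k z = (\<Sum>l<k. frame_coord (es ! l) z)"
  unfolding eigenvalue_sum_def using frame_coord_eigenvalue[OF assms(1)] assms(2) by simp

text \<open>\<open>eigenvalue_sum\<close> is a maximum of uniformly bounded linear functionals: a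
  frame optimal for \<open>z\<close> is tested at z'.\<close>

lemma eigenvalue_sum_lipschitz:
  obtains L where "0 < L" "\<And>k z z' :: 'a::euclidean_jordan_algebra. k \<le> jordan_rank TYPE('a) \<Longrightarrow>
     \<bar>eigenvalue_sum k z - eigenvalue_sum k z'\<bar> \<le> L * norm (z - z')"
proof -
  obtain L where L: "0 < L" "\<And>k (es :: 'a list) y. jordan_frame es \<Longrightarrow> k \<le> length es \<Longrightarrow>
     \<bar>\<Sum>l<k. frame_coord (es ! l) y\<bar> \<le> L * norm y"
    using initial_frame_coord_bounded by blast
  have one: "eigenvalue_sum k z - eigenvalue_sum k z' \<le> L * norm (z - z')"
    if k: "k \<le> jordan_rank TYPE('a)" for k and z z' :: 'a
  proof -
    obtain es where es: "spectral_decomposition z (eigenvalues z) es" using eigenvalues by metis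
    note fr = spectral_decompositionD(1)[OF es]
    have k': "k \<le> length es" using k jordan_frame_length[OF fr] by simp
    have "eigenvalue_sum k z = (\<Sum>l<k. frame_coord (es ! l) z') + (\<Sum>l<k. frame_coord (es ! l) (z - z'))"
      unfolding eigenvalue_sum_frame[OF es k'] by (simp add: frame_coord_simps flip: sum.distrib)
    also have "\<dots> \<le> eigenvalue_sum k z' + L * norm (z - z')"
      using eigenvalue_sum_ge[OF fr k', of z'] L(2)[OF fr k', of "z - z'"] by linarith
    finally show ?thesis by simp
  qed
  show thesis
  proof (rule that[OF L(1)])
    show "\<bar>eigenvalue_sum k z - eigenvalue_sum k z'\<bar> \<le> L * norm (z - z')"
      if "k \<le> jordan_rank TYPE('a)" for k and z z' :: 'a
      using one[OF that, of z z'] one[OF that, of z' z] by (simp add: norm_minus_commute)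
  qed
qed

section \<open>Euler approximation of the flow of the commutator field\<close>

lemma bounded_bilinear_commutator_field: "bounded_bilinear (commutator_field a)"
proof -
  have "bilinear (commutator_field a)"
    unfolding bilinear_def commutator_field_def
    by (auto intro!: linearI simp: jordan_simps algebra_simps)
  then show ?thesis by (simp add: bilinear_conv_bounded_bilinear)
qed

interpretation commutator_field: bounded_bilinear "commutator_field a"
  for a :: "'a::euclidean_jordan_algebra"
  by (rule bounded_bilinear_commutator_field)

lemma commutator_field_derivation:
  "commutator_field a x (u \<circ>\<^sub>J v) = commutator_field a x u \<circ>\<^sub>J v + u \<circ>\<^sub>J commutator_field a x v"
  unfolding commutator_field_def by (rule jordan_commutator_derivation)

lemma commutator_field_skew: "inner u (commutator_field a x u) = 0"
proof -
  have "inner u (x \<circ>\<^sub>J (a \<circ>\<^sub>J u)) = inner u (a \<circ>\<^sub>J (x \<circ>\<^sub>J u))"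
    by (metis inner_commute inner_jordan_mult)
  then show ?thesis by (simp add: commutator_field_def inner_diff)
qed

text \<open>A product of factors I + h D, each D taken at the current Euler iterate of
  \<open>x0\<close>. The argument \<open>v\<close> is arbitrary, so that one linear map acts on the
  whole algebra.\<close>

primrec euler_map :: "'a::euclidean_jordan_algebra \<Rightarrow> real \<Rightarrow> 'a \<Rightarrow> nat \<Rightarrow> 'a \<Rightarrow> 'a" where
  "euler_map a h x0 0 v = v"
| "euler_map a h x0 (Suc i) v = euler_map a h x0 i v +
     h *\<^sub>R commutator_field a (euler_map a h x0 i x0) (euler_map a h x0 i v)"

lemma linear_euler_map: "linear (euler_map a h x0 i)"
proof (induction i)
  case 0 show ?case by (rule linearI) simp_all
next
  case (Suc i)
  show ?case
    by (rule linearI) (simp_all add: linear_add[OF Suc] linear_scale[OF Suc]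
        commutator_field.add_right commutator_field.scaleR_right scaleR_add_right mult.commute)
qed

text \<open>Skewness makes every increment orthogonal to the current vector. The bound survives the
  limit and yields injectivity there.\<close>

lemma norm_euler_map_ge: "norm v \<le> norm (euler_map a h x0 i v)"
proof (induction i)
  case (Suc i)
  let ?u = "euler_map a h x0 i v" and ?x = "euler_map a h x0 i x0"
  have "(norm (?u + h *\<^sub>R commutator_field a ?x ?u))\<^sup>2 = (norm ?u)\<^sup>2 + (norm (h *\<^sub>R commutator_field a ?x ?u))\<^sup>2"
    by (simp add: norm_add_Pythagorean orthogonal_def commutator_field_skew)
  then have "(norm ?u)\<^sup>2 \<le> (norm (euler_map a h x0 (Suc i) v))\<^sup>2" by simp
  then have "norm ?u \<le> norm (euler_map a h x0 (Suc i) v)" by (rule power2_le_imp_le) simp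
  then show ?case using Suc by simp
qed simp

section \<open>A priori estimates for Euler products\<close>

context
  fixes a x0 :: "'a::euclidean_jordan_algebra" and h :: real and N :: nat and C J \<rho> R :: real
  assumes C: "0 < C" "\<And>x y. norm (commutator_field a x y) \<le> C * norm x * norm y"
    and J: "0 < J" "\<And>x y :: 'a. norm (x \<circ>\<^sub>J y) \<le> J * norm x * norm y"
    and R: "R = norm x0 + \<rho>" and \<rho>: "0 < \<rho>" and small: "real N * \<bar>h\<bar> * (C * R * R) \<le> \<rho>"
begin

lemma R_pos: "0 < R"
  using R \<rho> norm_ge_zero[of x0] by linarith

text \<open>On the ball of radius R the field is at most C R^2, and \<open>small\<close> keeps the
  first N iterates in that ball.\<close>

lemma euler_map_dist: "i \<le> N \<Longrightarrow> norm (euler_map a h x0 i x0 - x0) \<le> real i * \<bar>h\<bar> * (C * R * R)"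
proof (induction i)
  case (Suc i)
  let ?x = "euler_map a h x0 i x0"
  have pos: "0 \<le> \<bar>h\<bar> * (C * R * R)" using C R_pos by simp
  have "real i * \<bar>h\<bar> * (C * R * R) \<le> real N * \<bar>h\<bar> * (C * R * R)"
    unfolding mult.assoc using Suc.prems C R_pos by (intro mult_right_mono) auto
  then have "norm (?x - x0) \<le> \<rho>" using Suc small by linarith
  then have "norm ?x \<le> R" unfolding R by norm
  then have "C * norm ?x * norm ?x \<le> C * R * R"
    using C R_pos by (intro mult_mono) auto
  then have "norm (commutator_field a ?x ?x) \<le> C * R * R" using C(2) order_trans by blast
  then have "norm (h *\<^sub>R commutator_field a ?x ?x) \<le> \<bar>h\<bar> * (C * R * R)"
    by (simp add: mult_left_mono)
  moreover have "norm (?x - x0) \<le> real i * \<bar>h\<bar> * (C * R * R)" using Suc by simp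
  ultimately have "norm ((?x - x0) + h *\<^sub>R commutator_field a ?x ?x) \<le> real i * \<bar>h\<bar> * (C * R * R) + \<bar>h\<bar> * (C * R * R)"
    by (rule norm_triangle_mono[rotated])
  then show ?case by (simp add: algebra_simps)
qed simp

lemma euler_map_cball: "i \<le> N \<Longrightarrow> euler_map a h x0 i x0 \<in> cball x0 \<rho>"
proof -
  assume i: "i \<le> N"
  then have "real i * \<bar>h\<bar> * (C * R * R) \<le> real N * \<bar>h\<bar> * (C * R * R)"
    unfolding mult.assoc using C R_pos by (intro mult_right_mono) auto
  then show ?thesis using euler_map_dist[OF i] small by (simp add: dist_norm norm_minus_commute)
qed

lemma euler_map_R: "i \<le> N \<Longrightarrow> norm (euler_map a h x0 i x0) \<le> R"
  using euler_map_cball[of i] unfolding R by (simp add: dist_norm) norm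

lemma commutator_euler_bound:
  assumes "i \<le> N"
  shows "norm (commutator_field a (euler_map a h x0 i x0) u) \<le> C * R * norm u"
  using C(2)[of "euler_map a h x0 i x0" u] euler_map_R[OF assms] C(1) R_pos
  by (smt (verit) mult_left_mono mult_right_mono norm_ge_zero)

lemma euler_step_bound:
  assumes "i \<le> N"
  shows "norm (u + h *\<^sub>R commutator_field a (euler_map a h x0 i x0) u) \<le> (1 + \<bar>h\<bar> * (C * R)) * norm u"
proof -
  have "norm (u + h *\<^sub>R commutator_field a (euler_map a h x0 i x0) u) \<le>
     norm u + \<bar>h\<bar> * norm (commutator_field a (euler_map a h x0 i x0) u)"
    using norm_triangle_ineq[of u "h *\<^sub>R commutator_field a (euler_map a h x0 i x0) u"] by simp
  also have "\<dots> \<le> norm u + \<bar>h\<bar> * (C * R * norm u)"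
    using commutator_euler_bound[OF assms] by (intro add_left_mono mult_left_mono) auto
  finally show ?thesis by (simp add: algebra_simps)
qed

lemma euler_map_norm:
  assumes "i \<le> N"
  shows "norm (euler_map a h x0 i v) \<le> (1 + \<bar>h\<bar> * (C * R)) ^ i * norm v"
  using assms
proof (induction i)
  case (Suc i)
  have "norm (euler_map a h x0 (Suc i) v) \<le> (1 + \<bar>h\<bar> * (C * R)) * norm (euler_map a h x0 i v)"
    using euler_step_bound Suc.prems by simp
  also have "\<dots> \<le> (1 + \<bar>h\<bar> * (C * R)) * ((1 + \<bar>h\<bar> * (C * R)) ^ i * norm v)"
    using Suc C R_pos by (intro mult_left_mono) auto
  finally show ?case by (simp add: mult_ac)
qed simp

lemma growth_le: "i \<le> N \<Longrightarrow> (1 + \<bar>h\<bar> * (C * R)) ^ i \<le> exp (real N * \<bar>h\<bar> * (C * R))"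
proof -
  assume i: "i \<le> N"
  have "(1 + \<bar>h\<bar> * (C * R)) ^ i \<le> (1 + \<bar>h\<bar> * (C * R)) ^ N"
    using C R_pos i by (intro power_increasing) auto
  also have "\<dots> \<le> exp (\<bar>h\<bar> * (C * R)) ^ N"
    using C R_pos by (intro power_mono exp_ge_add_one_self) auto
  also have "\<dots> = exp (real N * \<bar>h\<bar> * (C * R))"
    by (simp add: exp_of_nat_mult mult.assoc)
  finally show ?thesis .
qed

text \<open>One Euler step is multiplicative up to the second-order term \<open>h\<^sup>2 Du \<circ> Dv\<close>.\<close>

lemma euler_map_defect:
  assumes "i \<le> N"
  defines "M \<equiv> J * (C * R * exp (real N * \<bar>h\<bar> * (C * R)))\<^sup>2"
  shows "norm (euler_map a h x0 i (u \<circ>\<^sub>J v) - euler_map a h x0 i u \<circ>\<^sub>J euler_map a h x0 i v)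
    \<le> real i * h\<^sup>2 * M * (1 + \<bar>h\<bar> * (C * R)) ^ i * norm u * norm v"
  using assms(1)
proof (induction i)
  case (Suc i)
  let ?D = "commutator_field a (euler_map a h x0 i x0)" and ?q = "1 + \<bar>h\<bar> * (C * R)"
  let ?u = "euler_map a h x0 i u" and ?v = "euler_map a h x0 i v" and ?E = "exp (real N * \<bar>h\<bar> * (C * R))"
  let ?d = "euler_map a h x0 i (u \<circ>\<^sub>J v) - ?u \<circ>\<^sub>J ?v"
  have i: "i \<le> N" using Suc by simp
  have q: "1 \<le> ?q" using C R_pos by simp
  have M: "0 \<le> M" using J unfolding M_def by simp
  \<comment> \<open>By the derivation property the old defect undergoes the same Euler step, and
    only the second-order term is new.\<close>
  have eq: "euler_map a h x0 (Suc i) (u \<circ>\<^sub>J v) - euler_map a h x0 (Suc i) u \<circ>\<^sub>J euler_map a h x0 (Suc i) v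
     = (?d + h *\<^sub>R ?D ?d) - h\<^sup>2 *\<^sub>R (?D ?u \<circ>\<^sub>J ?D ?v)"
    by (simp add: jordan_simps commutator_field.diff_right commutator_field_derivation algebra_simps power2_eq_square)
  have Du: "norm (?D (euler_map a h x0 i w)) \<le> C * R * (?E * norm w)" for w
  proof -
    have "norm (euler_map a h x0 i w) \<le> ?E * norm w"
      using euler_map_norm[OF i, of w] growth_le[OF i] by (meson mult_right_mono norm_ge_zero order_trans)
    then show ?thesis
      using commutator_euler_bound[OF i, of "euler_map a h x0 i w"] C(1) R_pos
      by (smt (verit) mult_left_mono mult_pos_pos)
  qed
  have "norm (?D ?u \<circ>\<^sub>J ?D ?v) \<le> J * norm (?D ?u) * norm (?D ?v)" by (rule J)
  also have "\<dots> \<le> J * (C * R * (?E * norm u)) * (C * R * (?E * norm v))"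
    using J C R_pos Du[of u] Du[of v] by (intro mult_mono mult_left_mono) auto
  also have "\<dots> = M * norm u * norm v"
    by (simp add: M_def power2_eq_square)
  finally have 1: "norm (h\<^sup>2 *\<^sub>R (?D ?u \<circ>\<^sub>J ?D ?v)) \<le> h\<^sup>2 * (M * norm u * norm v)"
    by (simp add: mult_left_mono)
  have "norm (?d + h *\<^sub>R ?D ?d) \<le> ?q * (real i * h\<^sup>2 * M * ?q ^ i * norm u * norm v)"
    using euler_step_bound[OF i, of ?d] Suc.IH[OF i] q by (smt (verit) mult_left_mono)
  then have 2: "norm (?d + h *\<^sub>R ?D ?d) \<le> real i * (h\<^sup>2 * (M * norm u * norm v)) * ?q ^ Suc i"
    by (simp add: mult_ac)
  have "h\<^sup>2 * (M * norm u * norm v) * 1 \<le> h\<^sup>2 * (M * norm u * norm v) * ?q ^ Suc i"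
    using q M by (intro mult_left_mono one_le_power) auto
  then have "norm ((?d + h *\<^sub>R ?D ?d) - h\<^sup>2 *\<^sub>R (?D ?u \<circ>\<^sub>J ?D ?v)) \<le>
     real i * (h\<^sup>2 * (M * norm u * norm v)) * ?q ^ Suc i + h\<^sup>2 * (M * norm u * norm v) * ?q ^ Suc i"
    using norm_triangle_ineq4[of "?d + h *\<^sub>R ?D ?d" "h\<^sup>2 *\<^sub>R (?D ?u \<circ>\<^sub>J ?D ?v)"] 1 2 by linarith
  also have "\<dots> = real (Suc i) * h\<^sup>2 * M * ?q ^ Suc i * norm u * norm v"
    by (simp add: algebra_simps)
  finally show ?case unfolding eq .
qed simp

lemma euler_map_functional:
  fixes \<psi> :: "'a \<Rightarrow> real"
  assumes step: "\<And>x. x \<in> cball x0 \<rho> \<Longrightarrow> \<psi> x + \<delta> \<le> \<psi> (x + h *\<^sub>R commutator_field a x x)"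
  shows "i \<le> N \<Longrightarrow> \<psi> x0 + real i * \<delta> \<le> \<psi> (euler_map a h x0 i x0)"
proof (induction i)
  case (Suc i)
  then have "\<psi> x0 + real i * \<delta> \<le> \<psi> (euler_map a h x0 i x0)" by simp
  moreover have "\<psi> (euler_map a h x0 i x0) + \<delta> \<le> \<psi> (euler_map a h x0 (Suc i) x0)"
    using step[OF euler_map_cball[of i]] Suc.prems by simp
  ultimately show ?case by (simp add: algebra_simps)
qed simp

end

section \<open>Passage to the limit of Euler products\<close>

text \<open>\<open>A\<close> is a subsequential limit of products of N steps of size sT/N. Errors of
  order h^2 per step add up to order 1/N and vanish. The quantifier over \<psi> stands inside
  because one automorphism must serve all functionals at once.\<close>

lemma commutator_flow:
  fixes a x0 :: "'a::euclidean_jordan_algebra"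
  assumes s: "\<bar>s\<bar> = 1" and \<rho>: "0 < \<rho>"
  shows "\<exists>T A. 0 < T \<and> jordan_automorphism A \<and> A x0 \<in> cball x0 \<rho> \<and>
    (\<forall>\<psi> \<kappa> B. continuous_on UNIV \<psi> \<longrightarrow>
      (\<forall>x h. x \<in> cball x0 \<rho> \<longrightarrow> 0 < h \<longrightarrow> h \<le> 1 \<longrightarrow>
         \<psi> x + h * \<kappa> - B * h\<^sup>2 \<le> \<psi> (x + (s * h) *\<^sub>R commutator_field a x x)) \<longrightarrow>
      \<psi> x0 + T * \<kappa> \<le> (\<psi> (A x0) :: real))"
proof -
  obtain C where C: "0 < C" "\<And>x y. norm (commutator_field a x y) \<le> C * norm x * norm y"
    using commutator_field.pos_bounded[of a] by (metis mult.commute mult.left_commute)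
  obtain J where J: "0 < J" "\<And>x y :: 'a. norm (x \<circ>\<^sub>J y) \<le> J * norm x * norm y"
    using jordan_mult.pos_bounded by (metis mult.commute mult.left_commute)
  define R where "R = norm x0 + \<rho>"
  have R: "0 < R" using \<rho> norm_ge_zero[of x0] unfolding R_def by linarith
  \<comment> \<open>The total time bounds the displacement by \<rho> and each step size by
    1.\<close>
  define T where "T = min 1 (\<rho> / (C * R * R))"
  have T: "0 < T" "T \<le> 1" "T * (C * R * R) \<le> \<rho>"
    using C R \<rho> by (auto simp: T_def min_def field_simps)
  define H where "H n = s * (T / real (Suc n))" for n
  have H: "\<bar>H n\<bar> = T / real (Suc n)" for n
    using s T by (simp add: H_def abs_mult)
  then have NH: "real (Suc n) * \<bar>H n\<bar> = T" for n by (simp del: of_nat_Suc)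
  have small: "real (Suc n) * \<bar>H n\<bar> * (C * R * R) \<le> \<rho>" for n
    unfolding NH by (rule T)
  note est = C J R_def \<rho> small
  define G where "G n = euler_map a (H n) x0 (Suc n)" for n
  define E where "E = exp (T * (C * R))"
  have growth: "(1 + \<bar>H n\<bar> * (C * R)) ^ Suc n \<le> E" for n
    using growth_le[OF est, of "Suc n" n] unfolding NH E_def by simp
  have linG: "bounded_linear (G n)" for n
    unfolding G_def by (intro linear_conv_bounded_linear[THEN iffD1] linear_euler_map)
  \<comment> \<open>As bounded operators the products lie in a space with the Heine-Borel property,
    which provides the convergent subsequence.\<close>
  define F where "F n = Blinfun (G n)" for n
  have F: "blinfun_apply (F n) = G n" for n
    unfolding F_def by (rule bounded_linear_Blinfun_apply[OF linG])
  have "norm (F n) \<le> E" for n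
  proof (rule norm_blinfun_bound)
    show "norm (blinfun_apply (F n) v) \<le> E * norm v" for v
      using euler_map_norm[OF est, of "Suc n" n v] growth[of n] unfolding F G_def
      by (meson mult_right_mono norm_ge_zero order_refl order_trans)
  qed (simp add: E_def)
  then have "bounded (range F)" by (auto simp: bounded_iff)
  then obtain l r where r: "strict_mono r" and lim: "(F \<circ> r) \<longlonglongrightarrow> l"
    using bounded_imp_convergent_subsequence by blast
  define A where "A = blinfun_apply l"
  have GA: "(\<lambda>n. G (r n) v) \<longlonglongrightarrow> A v" for v
    unfolding A_def F[symmetric] using lim by (auto intro!: tendsto_intros simp: o_def)
  have inv: "(\<lambda>n. 1 / real (Suc (r n))) \<longlonglongrightarrow> 0"
    using LIMSEQ_subseq_LIMSEQ[OF LIMSEQ_inverse_real_of_nat r] by (simp add: o_def inverse_eq_divide)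
  have lin: "linear A" unfolding A_def by (rule blinfun.bounded_linear_right[THEN bounded_linear.linear])
  have ge: "norm v \<le> norm (A v)" for v
    by (rule LIMSEQ_le_const[OF tendsto_norm[OF GA]]) (simp add: G_def norm_euler_map_ge del: euler_map.simps)
  \<comment> \<open>A linear map that does not decrease norms is injective, hence bijective in
    finite dimension.\<close>
  have "inj A" unfolding linear_injective_0[OF lin]
  proof (intro allI impI)
    show "v = 0" if "A v = 0" for v using ge[of v] that by simp
  qed
  then have "bij A" using lin by (simp add: bij_def linear_injective_imp_surjective)
  have mult: "A (u \<circ>\<^sub>J v) = A u \<circ>\<^sub>J A v" for u v
  proof -
    define M where "M = J * (C * R * E)\<^sup>2"
    have bound: "norm (G n (u \<circ>\<^sub>J v) - G n u \<circ>\<^sub>J G n v) \<le> (T\<^sup>2 * M * E * norm u * norm v) * (1 / real (Suc n))" for n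
    proof -
      have M: "0 \<le> M" using J by (simp add: M_def)
      have "norm (G n (u \<circ>\<^sub>J v) - G n u \<circ>\<^sub>J G n v) \<le>
         real (Suc n) * (H n)\<^sup>2 * M * (1 + \<bar>H n\<bar> * (C * R)) ^ Suc n * norm u * norm v"
        using euler_map_defect[OF est, of "Suc n" n u v] unfolding NH G_def M_def E_def by blast
      also have "\<dots> \<le> real (Suc n) * (H n)\<^sup>2 * M * E * norm u * norm v"
        using growth[of n] M by (intro mult_right_mono mult_left_mono) auto
      also have "(H n)\<^sup>2 = (T / real (Suc n))\<^sup>2" using H[of n] by (metis power2_abs)
      finally show ?thesis by (simp add: power2_eq_square field_simps del: of_nat_Suc)
    qed
    have "(\<lambda>n. G (r n) (u \<circ>\<^sub>J v) - G (r n) u \<circ>\<^sub>J G (r n) v) \<longlonglongrightarrow> 0"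
      by (rule Lim_null_comparison[OF always_eventually tendsto_mult_right_zero[OF inv, of "T\<^sup>2 * M * E * norm u * norm v"]])
        (intro allI bound)
    moreover have "(\<lambda>n. G (r n) (u \<circ>\<^sub>J v) - G (r n) u \<circ>\<^sub>J G (r n) v) \<longlonglongrightarrow> A (u \<circ>\<^sub>J v) - A u \<circ>\<^sub>J A v"
      by (intro tendsto_diff GA jordan_mult.tendsto)
    ultimately have "A (u \<circ>\<^sub>J v) - A u \<circ>\<^sub>J A v = 0" by (rule LIMSEQ_unique[symmetric])
    then show ?thesis by simp
  qed
  show ?thesis
  proof (intro exI[of _ T] exI[of _ A] conjI allI impI T(1))
    show "jordan_automorphism A"
      using lin \<open>bij A\<close> mult by (simp add: jordan_automorphism_def)
    show "A x0 \<in> cball x0 \<rho>"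
    proof (rule Lim_in_closed_set[OF closed_cball always_eventually sequentially_bot GA], rule allI)
      show "G (r n) x0 \<in> cball x0 \<rho>" for n
        unfolding G_def by (rule euler_map_cball[OF est order_refl])
    qed
  next
    fix \<psi> :: "'a \<Rightarrow> real" and \<kappa> B
    assume cont: "continuous_on UNIV \<psi>" and
      step: "\<forall>x h. x \<in> cball x0 \<rho> \<longrightarrow> 0 < h \<longrightarrow> h \<le> 1 \<longrightarrow>
         \<psi> x + h * \<kappa> - B * h\<^sup>2 \<le> \<psi> (x + (s * h) *\<^sub>R commutator_field a x x)"
    have bound: "\<psi> x0 + T * \<kappa> - (B * T\<^sup>2) * (1 / real (Suc n)) \<le> \<psi> (G n x0)" for n
    proof -
      let ?h = "T / real (Suc n)"
      have h: "0 < ?h" "?h \<le> 1" using T by (auto simp: divide_le_eq)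
      have st: "\<psi> x + (?h * \<kappa> - B * ?h\<^sup>2) \<le> \<psi> (x + H n *\<^sub>R commutator_field a x x)" if "x \<in> cball x0 \<rho>" for x
        using step[rule_format, OF that h] unfolding H_def by simp
      have "\<psi> x0 + real (Suc n) * (?h * \<kappa> - B * ?h\<^sup>2) \<le> \<psi> (G n x0)"
        unfolding G_def by (rule euler_map_functional[where \<psi> = \<psi> and i = "Suc n" and N = "Suc n", OF est st order_refl])
      moreover have "real (Suc n) * (?h * \<kappa> - B * ?h\<^sup>2) = T * \<kappa> - (B * T\<^sup>2) * (1 / real (Suc n))"
        by (simp add: power2_eq_square field_simps del: of_nat_Suc)
      ultimately show ?thesis by linarith
    qed
    have "(\<lambda>n. \<psi> x0 + T * \<kappa> - (B * T\<^sup>2) * (1 / real (Suc (r n)))) \<longlonglongrightarrow> \<psi> x0 + T * \<kappa> - (B * T\<^sup>2) * 0"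
      by (intro tendsto_diff tendsto_mult tendsto_const inv)
    moreover have "(\<lambda>n. \<psi> (G (r n) x0)) \<longlonglongrightarrow> \<psi> (A x0)"
      using cont by (intro isCont_tendsto_compose[OF _ GA]) (simp add: continuous_on_eq_continuous_at)
    ultimately have "\<psi> x0 + T * \<kappa> - (B * T\<^sup>2) * 0 \<le> \<psi> (A x0)"
      by (rule LIMSEQ_le) (intro exI allI impI bound)
    then show "\<psi> x0 + T * \<kappa> \<le> \<psi> (A x0)" by simp
  qed
qed

section \<open>Majorization along the flow\<close>

lemma sum_list_take_eigenvalues:
  fixes z :: "'a::euclidean_jordan_algebra"
  assumes "k \<le> jordan_rank TYPE('a)"
  shows "sum_list (take k (eigenvalues z)) = eigenvalue_sum k z"
  using assms by (simp add: sum_list_sum_nth eigenvalue_sum_def length_eigenvalues min_absorb2 atLeast0LessThan)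

lemma decr_eigenvalues: "decr (eigenvalues z) = eigenvalues z"
proof -
  have "sorted_wrt (\<ge>) (eigenvalues z)" using eigenvalues by blast
  then have "sorted (rev (eigenvalues z))" by (simp add: sorted_wrt_rev)
  then have "sort (eigenvalues z) = rev (eigenvalues z)" by (intro properties_for_sort) auto
  then show ?thesis by (simp add: decr_def)
qed

lemma majorized_eigenvalues:
  fixes z z' :: "'a::euclidean_jordan_algebra"
  assumes "\<And>k. k \<le> jordan_rank TYPE('a) \<Longrightarrow> eigenvalue_sum k z \<le> eigenvalue_sum k z'"
    and "eigenvalue_sum (jordan_rank TYPE('a)) z = eigenvalue_sum (jordan_rank TYPE('a)) z'"
  shows "eigenvalues z \<prec>\<^sub>M eigenvalues z'"
proof -
  have "sum_list (eigenvalues y) = eigenvalue_sum (jordan_rank TYPE('a)) y" for y :: 'a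
    using sum_list_take_eigenvalues[of "jordan_rank TYPE('a)" y] by (simp add: length_eigenvalues)
  then show ?thesis
    using assms by (simp add: majorized_def decr_eigenvalues length_eigenvalues sum_list_take_eigenvalues)
qed

lemma eigenvalue_sum_continuous:
  fixes f :: "'b::topological_space \<Rightarrow> 'a::euclidean_jordan_algebra"
  assumes "k \<le> jordan_rank TYPE('a)" "continuous_on S f"
  shows "continuous_on S (\<lambda>x. eigenvalue_sum k (f x))"
proof -
  obtain L where L: "0 < L" "\<And>z z' :: 'a. \<bar>eigenvalue_sum k z - eigenvalue_sum k z'\<bar> \<le> L * norm (z - z')"
    using eigenvalue_sum_lipschitz assms(1) by metis
  have "L-lipschitz_on UNIV (eigenvalue_sum k :: 'a \<Rightarrow> real)"
    using L by (intro lipschitz_onI) (auto simp: dist_norm)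
  then have "continuous_on UNIV (eigenvalue_sum k :: 'a \<Rightarrow> real)" by (rule lipschitz_on_continuous_on)
  then show ?thesis using assms(2) by (rule continuous_on_compose2) auto
qed

section \<open>Effect of one Euler step on the eigenvalue sums\<close>

text \<open>The frame of x - a is tested at the moved point, where its coordinate sum has grown
  linearly in h; no error term arises in this direction.\<close>

lemma eigenvalue_sum_step_up:
  fixes a x :: "'a::euclidean_jordan_algebra"
  assumes k: "k \<le> jordan_rank TYPE('a)" and h: "0 \<le> h"
  shows "eigenvalue_sum k (x - a) \<le> eigenvalue_sum k (x + h *\<^sub>R commutator_field a x x - a)"
proof -
  obtain es where es: "spectral_decomposition (x - a) (eigenvalues (x - a)) es"
    and sorted: "sorted_wrt (\<ge>) (eigenvalues (x - a))"
    using eigenvalues by blast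
  note fr = spectral_decompositionD(1)[OF es]
  have k': "k \<le> length es" using k jordan_frame_length[OF fr] by simp
  have "x + h *\<^sub>R commutator_field a x x - a = (x - a) + h *\<^sub>R commutator_field a x x" by simp
  then have "(\<Sum>l<k. frame_coord (es ! l) (x + h *\<^sub>R commutator_field a x x - a)) =
      eigenvalue_sum k (x - a) + h * (\<Sum>l<k. frame_coord (es ! l) (commutator_field a x x))"
    unfolding eigenvalue_sum_frame[OF es k'] by (simp only: frame_coord_simps) (simp add: sum.distrib sum_distrib_left)
  moreover have "0 \<le> (\<Sum>l<k. frame_coord (es ! l) (commutator_field a x x))"
    by (rule initial_sum_commutator_field(1)[OF es _ k' sorted]) simp
  ultimately show ?thesis
    using eigenvalue_sum_ge[OF fr k', of "x + h *\<^sub>R commutator_field a x x - a"] h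
    by (smt (verit) mult_nonneg_nonneg)
qed

text \<open>Backwards, the monotonicity of the partial sums is exact at the endpoint of a step; replacing the
  field at the endpoint by the field at the starting point costs a second-order error.\<close>

lemma eigenvalue_sum_step_down:
  fixes a x0 :: "'a::euclidean_jordan_algebra"
  shows "\<exists>B\<ge>0. \<forall>k x h. k \<le> jordan_rank TYPE('a) \<longrightarrow> x \<in> cball x0 \<rho> \<longrightarrow> 0 \<le> h \<longrightarrow> h \<le> 1 \<longrightarrow>
    eigenvalue_sum k (x - h *\<^sub>R commutator_field a x x - a) \<le> eigenvalue_sum k (x - a) + B * h\<^sup>2"
proof -
  obtain C where C: "0 < C" "\<And>x y. norm (commutator_field a x y) \<le> C * norm x * norm y"
    using commutator_field.pos_bounded[of a] by (metis mult.commute mult.left_commute)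
  obtain L where L: "0 < L" "\<And>k (es :: 'a list) y. jordan_frame es \<Longrightarrow> k \<le> length es \<Longrightarrow>
     \<bar>\<Sum>l<k. frame_coord (es ! l) y\<bar> \<le> L * norm y"
    using initial_frame_coord_bounded by blast
  define R where "R = norm x0 + \<bar>\<rho>\<bar>"
  define K where "K = C * R * R"
  \<comment> \<open>The constant comes from the bilinear estimate of the field at x minus the field
    at y, with the distance of x and y at most hK and the norm of y at most R + K.\<close>
  define B where "B = L * (C * K * R + C * (R + K) * K)"
  have R: "0 \<le> R" by (simp add: R_def)
  have K: "0 \<le> K" using C R by (simp add: K_def)
  have "eigenvalue_sum k (x - h *\<^sub>R commutator_field a x x - a) \<le> eigenvalue_sum k (x - a) + B * h\<^sup>2"
    if k: "k \<le> jordan_rank TYPE('a)" and x: "x \<in> cball x0 \<rho>" and h: "0 \<le> h" "h \<le> 1" for k x h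
  proof -
    let ?E = "\<lambda>x. commutator_field a x x"
    define y where "y = x - h *\<^sub>R ?E x"
    have xR: "norm x \<le> R" using x unfolding R_def by (simp add: dist_norm) norm
    have "norm (?E x) \<le> C * norm x * norm x" by (rule C)
    also have "\<dots> \<le> K" unfolding K_def using C(1) xR R by (intro mult_mono) auto
    finally have EK: "norm (?E x) \<le> K" .
    have xy: "norm (x - y) \<le> h * K" using EK h by (simp add: y_def mult_left_mono)
    have "h * K \<le> 1 * K" using h K by (intro mult_right_mono) auto
    then have yR: "norm y \<le> R + K" using xy xR norm_triangle_ineq4[of x "x - y"] by simp
    have "?E x - ?E y = commutator_field a (x - y) x + commutator_field a y (x - y)"
      by (simp add: commutator_field.diff_left commutator_field.diff_right)
    then have "norm (?E x - ?E y) \<le> C * norm (x - y) * norm x + C * norm y * norm (x - y)"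
      using norm_triangle_mono[OF C(2) C(2)] by metis
    also have "\<dots> \<le> C * (h * K) * R + C * (R + K) * (h * K)"
      using C(1) xy xR yR R K h by (intro add_mono mult_mono) auto
    finally have diff: "L * norm (?E x - ?E y) \<le> h * B"
      using mult_left_mono[of _ _ L] L(1) unfolding B_def by (fastforce simp: algebra_simps)
    \<comment> \<open>The frame belongs to the endpoint of the step, where the coordinate sum is
      exact.\<close>
    obtain es where es: "spectral_decomposition (y - a) (eigenvalues (y - a)) es"
      and sorted: "sorted_wrt (\<ge>) (eigenvalues (y - a))"
      using eigenvalues by blast
    note fr = spectral_decompositionD(1)[OF es]
    have k': "k \<le> length es" using k jordan_frame_length[OF fr] by simp
    define \<phi> where "\<phi> z = (\<Sum>l<k. frame_coord (es ! l) z)" for z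
    have lin: "\<phi> (u + c *\<^sub>R v) = \<phi> u + c * \<phi> v" for u v c
      by (simp add: \<phi>_def frame_coord_simps sum.distrib sum_distrib_left)
    have Ey: "0 \<le> \<phi> (?E y)"
      unfolding \<phi>_def by (rule initial_sum_commutator_field(1)[OF es _ k' sorted]) simp
    have "\<phi> (?E x) = \<phi> (?E y) + \<phi> (?E x - ?E y)" using lin[of "?E y" 1 "?E x - ?E y"] by simp
    then have "- (h * B) \<le> \<phi> (?E x)"
      using Ey L(2)[OF fr k', of "?E x - ?E y"] diff unfolding \<phi>_def[symmetric] by linarith
    then have "h * - (h * B) \<le> h * \<phi> (?E x)" using h by (intro mult_left_mono)
    moreover have "eigenvalue_sum k (y - a) = \<phi> (x - a) - h * \<phi> (?E x)"
    proof -
      have "eigenvalue_sum k (y - a) = \<phi> (y - a)" unfolding \<phi>_def by (rule eigenvalue_sum_frame[OF es k'])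
      also have "\<phi> (y - a) = \<phi> ((x - a) + (- h) *\<^sub>R ?E x)"
        by (rule arg_cong[where f = \<phi>]) (simp add: y_def)
      also have "\<dots> = \<phi> (x - a) + (- h) * \<phi> (?E x)" by (rule lin)
      finally show ?thesis by simp
    qed
    moreover have "\<phi> (x - a) \<le> eigenvalue_sum k (x - a)"
      unfolding \<phi>_def by (rule eigenvalue_sum_ge[OF fr k'])
    ultimately show ?thesis unfolding y_def by (simp add: power2_eq_square mult_ac)
  qed
  moreover have "0 \<le> B" using L(1) C(1) R K by (simp add: B_def)
  ultimately show ?thesis by blast
qed

lemma eigenvalue_sum_trace:
  assumes "jordan_frame (es :: 'a::euclidean_jordan_algebra list)"
  shows "eigenvalue_sum (jordan_rank TYPE('a)) z = inner (frame_trace es) z"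
proof -
  obtain fs where fs: "spectral_decomposition z (eigenvalues z) fs" using eigenvalues by blast
  then show ?thesis
    using frame_coord_sum_eq[OF fs assms] jordan_frame_length[OF spectral_decompositionD(1)[OF fs]]
    by (simp add: inner_frame_trace eigenvalue_sum_def)
qed

lemma trace_commutator_field:
  assumes "jordan_frame (es :: 'a::euclidean_jordan_algebra list)"
  shows "inner (frame_trace es) (commutator_field a x x) = 0"
proof -
  obtain fs where fs: "spectral_decomposition (x - a) (eigenvalues (x - a)) fs"
    and sorted: "sorted_wrt (\<ge>) (eigenvalues (x - a))"
    using eigenvalues by blast
  show ?thesis
    unfolding frame_trace_eq[OF assms spectral_decompositionD(1)[OF fs]] inner_frame_trace
    by (rule initial_sum_commutator_field(2)[OF fs _ order_refl sorted refl]) simp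
qed

text \<open>The flow is applied to the eigenvalue sums, to the trace and to the trace of the square.
  The first two give majorization in the direction of \<open>s\<close>, the third shows that the
  spectrum really changes.\<close>

lemma majorizing_automorphism:
  fixes a x0 :: "'a::euclidean_jordan_algebra" and s :: real
  assumes s: "s = 1 \<or> s = - 1" and nc: "\<not> operator_commute a x0" and U: "open U" "x0 \<in> U"
  obtains A where "jordan_automorphism A" "A x0 \<in> U" "eigenvalues (A x0 - a) \<noteq> eigenvalues (x0 - a)"
    "if s = 1 then eigenvalues (x0 - a) \<prec>\<^sub>M eigenvalues (A x0 - a) else eigenvalues (A x0 - a) \<prec>\<^sub>M eigenvalues (x0 - a)"
proof -
  let ?n = "jordan_rank TYPE('a)" and ?E = "\<lambda>x. commutator_field a x x"
  obtain es where es: "spectral_decomposition (x0 - a) (eigenvalues (x0 - a)) es"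
    using eigenvalues by blast
  note fr = spectral_decompositionD(1)[OF es]
  define g where "g = frame_trace es"
  \<comment> \<open>The derivative along the field of Q(x - a), where \<open>Q\<close> is the trace
    of the square.\<close>
  define rate where "rate x = 2 * inner (g \<circ>\<^sub>J (x - a)) (?E x)" for x
  define Q where "Q z = inner (g \<circ>\<^sub>J z) z" for z
  have contE: "continuous_on S ?E" for S
    by (intro commutator_field.continuous_on continuous_on_id)
  have contg: "continuous_on S (\<lambda>x. g \<circ>\<^sub>J f x)" if "continuous_on S f" for S f
    by (intro jordan_mult.continuous_on continuous_on_const that)
  have rate0: "rate x0 > 0"
    using commutator_rate_nonneg[OF es, of a x0] commutator_rate_zero[OF es, of a x0] nc
    by (fastforce simp: rate_def g_def)
  have "continuous_on UNIV rate"
    unfolding rate_def by (intro continuous_intros contE contg)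
  then have "open {x. rate x0 / 2 < rate x}"
    by (intro open_Collect_less continuous_on_const)
  then have "open (U \<inter> {x. rate x0 / 2 < rate x})" using U by blast
  \<comment> \<open>The ball is chosen so small that the rate stays above half its initial
    value.\<close>
  moreover have "x0 \<in> U \<inter> {x. rate x0 / 2 < rate x}" using U rate0 by simp
  ultimately obtain \<rho> where \<rho>: "0 < \<rho>" "cball x0 \<rho> \<subseteq> U \<inter> {x. rate x0 / 2 < rate x}"
    using open_contains_cball by blast
  have "bounded ((\<lambda>x. Q (?E x)) ` cball x0 \<rho>)"
    unfolding Q_def by (intro compact_imp_bounded compact_continuous_image continuous_intros contE contg compact_cball)
  then obtain M where "\<forall>x\<in>cball x0 \<rho>. \<bar>Q (?E x)\<bar> \<le> M" by (auto simp: bounded_iff)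
  then have M: "\<bar>Q (?E x)\<bar> \<le> M" if "x \<in> cball x0 \<rho>" for x using that by blast
  obtain B where B: "0 \<le> B" "\<And>k x h. k \<le> ?n \<Longrightarrow> x \<in> cball x0 \<rho> \<Longrightarrow> 0 \<le> h \<Longrightarrow> h \<le> 1 \<Longrightarrow>
    eigenvalue_sum k (x - h *\<^sub>R ?E x - a) \<le> eigenvalue_sum k (x - a) + B * h\<^sup>2"
    using eigenvalue_sum_step_down[of x0 \<rho> a] by blast
  have s1: "\<bar>s\<bar> = 1" using s by auto
  obtain T A where T: "0 < T" and A: "jordan_automorphism A" "A x0 \<in> cball x0 \<rho>"
    and flow: "\<forall>\<psi> \<kappa> B. continuous_on UNIV \<psi> \<longrightarrow>
      (\<forall>x h. x \<in> cball x0 \<rho> \<longrightarrow> 0 < h \<longrightarrow> h \<le> 1 \<longrightarrow>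
         \<psi> x + h * \<kappa> - B * h\<^sup>2 \<le> \<psi> (x + (s * h) *\<^sub>R ?E x)) \<longrightarrow>
      \<psi> x0 + T * \<kappa> \<le> (\<psi> (A x0) :: real)"
    using commutator_flow[OF s1 \<rho>(1), of x0 a] by (elim exE conjE)
  note flow = flow[rule_format]
  have sums: "s * eigenvalue_sum k (x0 - a) \<le> s * eigenvalue_sum k (A x0 - a)" if k: "k \<le> ?n" for k
  proof -
    have "s * eigenvalue_sum k (x0 - a) + T * 0 \<le> s * eigenvalue_sum k (A x0 - a)"
    proof (rule flow)
      show "continuous_on UNIV (\<lambda>x. s * eigenvalue_sum k (x - a))"
        by (intro continuous_intros eigenvalue_sum_continuous k)
      show "s * eigenvalue_sum k (x - a) + h * 0 - B * h\<^sup>2 \<le> s * eigenvalue_sum k (x + (s * h) *\<^sub>R ?E x - a)"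
        if "x \<in> cball x0 \<rho>" "0 < h" "h \<le> 1" for x h
        using s
      proof
        assume "s = 1"
        moreover have "0 \<le> B * h\<^sup>2" using B(1) by simp
        ultimately show ?thesis using eigenvalue_sum_step_up[OF k, of h x a] that by simp
      next
        assume "s = - 1"
        then show ?thesis using B(2)[OF k that(1), of h] that by simp
      qed
    qed
    then show ?thesis by simp
  qed
  have total: "eigenvalue_sum ?n (A x0 - a) = eigenvalue_sum ?n (x0 - a)"
  proof -
    \<comment> \<open>Both signs of the factor are used, which turns the inequality into
      conservation of the trace.\<close>
    have *: "c * eigenvalue_sum ?n (x0 - a) + T * 0 \<le> c * eigenvalue_sum ?n (A x0 - a)" for c
    proof (rule flow)
      show "continuous_on UNIV (\<lambda>x. c * eigenvalue_sum ?n (x - a))"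
        by (intro continuous_intros eigenvalue_sum_continuous order_refl)
      show "c * eigenvalue_sum ?n (x - a) + h * 0 - 0 * h\<^sup>2 \<le> c * eigenvalue_sum ?n (x + (s * h) *\<^sub>R ?E x - a)" for x h
        unfolding eigenvalue_sum_trace[OF fr]
        by (simp add: inner_diff inner_add trace_commutator_field[OF fr])
    qed
    show ?thesis using *[of 1] *[of "- 1"] by simp
  qed
  have "s * Q (x0 - a) + T * (rate x0 / 2) \<le> s * Q (A x0 - a)"
  proof (rule flow)
    show "continuous_on UNIV (\<lambda>x. s * Q (x - a))"
      unfolding Q_def by (intro continuous_intros contg)
    fix x h assume x: "x \<in> cball x0 \<rho>" and h: "0 < h" "h \<le> (1::real)"
    have Q_add: "Q (u + c *\<^sub>R v) = Q u + c * (2 * inner (g \<circ>\<^sub>J u) v) + c\<^sup>2 * Q v" for u v c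
    proof -
      have "inner (g \<circ>\<^sub>J v) u = inner (g \<circ>\<^sub>J u) v" by (metis inner_commute inner_jordan_mult)
      then show ?thesis
        by (simp add: Q_def jordan_simps inner_simps power2_eq_square algebra_simps)
    qed
    have "x + (s * h) *\<^sub>R ?E x - a = (x - a) + (s * h) *\<^sub>R ?E x" by simp
    then have "Q (x + (s * h) *\<^sub>R ?E x - a) = Q (x - a) + s * h * rate x + (s * h)\<^sup>2 * Q (?E x)"
      by (simp only: Q_add rate_def)
    moreover have "s * s = 1" using s by auto
    ultimately have eq: "s * Q (x + (s * h) *\<^sub>R ?E x - a) = s * Q (x - a) + h * rate x + h\<^sup>2 * (s * Q (?E x))"
      by (simp add: power2_eq_square algebra_simps)
    have "h * (rate x0 / 2) \<le> h * rate x" using \<rho>(2) x h by (intro mult_left_mono) auto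
    moreover have "h\<^sup>2 * - M \<le> h\<^sup>2 * (s * Q (?E x))"
      using M[OF x] s by (intro mult_left_mono) auto
    ultimately show "s * Q (x - a) + h * (rate x0 / 2) - M * h\<^sup>2 \<le> s * Q (x + (s * h) *\<^sub>R ?E x - a)"
      unfolding eq by (simp add: mult.commute)
  qed
  moreover have "0 < T * (rate x0 / 2)" using T rate0 by simp
  ultimately have "Q (A x0 - a) \<noteq> Q (x0 - a)" by auto
  moreover have "Q z = (\<Sum>i<?n. (eigenvalues z ! i)\<^sup>2)" for z
  proof -
    obtain fs where fs: "spectral_decomposition z (eigenvalues z) fs" using eigenvalues by blast
    note fr' = spectral_decompositionD(1)[OF fs]
    show ?thesis
      unfolding Q_def g_def frame_trace_eq[OF fr fr'] frame_trace_quadratic[OF fs] jordan_frame_length[OF fr'] ..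
  qed
  ultimately have "eigenvalues (A x0 - a) \<noteq> eigenvalues (x0 - a)" by metis
  moreover have "if s = 1 then eigenvalues (x0 - a) \<prec>\<^sub>M eigenvalues (A x0 - a)
    else eigenvalues (A x0 - a) \<prec>\<^sub>M eigenvalues (x0 - a)"
    using s sums total by (auto intro!: majorized_eigenvalues)
  ultimately show thesis using that A \<rho>(2) by blast
qed

theorem theorem5p1:
  fixes a x\<^sub>0 :: "'a::euclidean_jordan_algebra"
    and F :: "'a \<Rightarrow> real"
    and \<Omega> :: "'a set"
  assumes "strictly_schur_convex_spectral F"
    and "weakly_spectral \<Omega>"
    and "local_minimizer (\<lambda>x. F (x - a)) \<Omega> x\<^sub>0 \<or> local_maximizer (\<lambda>x. F (x - a)) \<Omega> x\<^sub>0"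
  shows "operator_commute a x\<^sub>0"
proof (rule ccontr)
  assume nc: "\<not> operator_commute a x\<^sub>0"
  obtain f where f: "\<And>x. F x = f (eigenvalues x)" "strictly_schur_convex (jordan_rank TYPE('a)) f"
    using assms(1) by (auto simp: strictly_schur_convex_spectral_def spectral_function_of_def)
  \<comment> \<open>Eigenvalue lists are already nonincreasing, so \<open>decr\<close> fixes them
    and strict Schur-convexity applies directly.\<close>
  have less: "F z < F z'" if "eigenvalues z \<prec>\<^sub>M eigenvalues z'" "eigenvalues z \<noteq> eigenvalues z'" for z z'
    using f(2) that unfolding strictly_schur_convex_def f(1)
    by (auto simp: length_eigenvalues decr_eigenvalues)
  from assms(3) show False
  proof
    assume "local_minimizer (\<lambda>x. F (x - a)) \<Omega> x\<^sub>0"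
    then obtain U where U: "open U" "x\<^sub>0 \<in> U" "x\<^sub>0 \<in> \<Omega>" "\<And>x. x \<in> \<Omega> \<inter> U \<Longrightarrow> F (x\<^sub>0 - a) \<le> F (x - a)"
      by (auto simp: local_minimizer_def)
    \<comment> \<open>A minimiser is refuted by moving strictly down in the majorization order, a
      maximiser by moving strictly up.\<close>
    obtain A where A: "jordan_automorphism A" "A x\<^sub>0 \<in> U" "eigenvalues (A x\<^sub>0 - a) \<noteq> eigenvalues (x\<^sub>0 - a)"
      "eigenvalues (A x\<^sub>0 - a) \<prec>\<^sub>M eigenvalues (x\<^sub>0 - a)"
      using majorizing_automorphism[OF _ nc U(1,2), of "- 1"] by auto
    have "A x\<^sub>0 \<in> \<Omega>" using assms(2) A(1) U(3) by (auto simp: weakly_spectral_def)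
    then show False using U(4)[of "A x\<^sub>0"] less[OF A(4,3)] A(2) by auto
  next
    assume "local_maximizer (\<lambda>x. F (x - a)) \<Omega> x\<^sub>0"
    then obtain U where U: "open U" "x\<^sub>0 \<in> U" "x\<^sub>0 \<in> \<Omega>" "\<And>x. x \<in> \<Omega> \<inter> U \<Longrightarrow> F (x - a) \<le> F (x\<^sub>0 - a)"
      by (auto simp: local_maximizer_def)
    obtain A where A: "jordan_automorphism A" "A x\<^sub>0 \<in> U" "eigenvalues (A x\<^sub>0 - a) \<noteq> eigenvalues (x\<^sub>0 - a)"
      "eigenvalues (x\<^sub>0 - a) \<prec>\<^sub>M eigenvalues (A x\<^sub>0 - a)"
      using majorizing_automorphism[OF _ nc U(1,2), of 1] by auto
    have "A x\<^sub>0 \<in> \<Omega>" using assms(2) A(1) U(3) by (auto simp: weakly_spectral_def)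
    then show False using U(4)[of "A x\<^sub>0"] less[OF A(4) A(3)[symmetric]] A(2) by auto
  qed
qed

end
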